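(* There exist constants $c,C>0$ such that the following holds. Consider the model $Y=X\beta^*+W$ with parameters $n,p,k,\sigma^2$, where $k\le p/3$, $\sigma^2\le c\min\left\{k,\frac{\log p}{\log\log p}\right\}$, $n\ge C k\log p$, and $\beta^*\in\mathbb R^p$ has exactly $k$ non-zero coordinates and satisfies $|\beta^*|_{\min}\ge1$. Then w.h.p. as $k\to+\infty$ the optimization problem $$(\tilde\Phi_2)\qquad \min\ \|Y-X\beta\|_2\quad\text{subject to}\quad \|\beta\|_0\le k$$ has no non-trivial local minima.
   Context: Model: $n,p,k$ are positive integers and $\sigma>0$; $X\in\mathbb R^{n\times p}$ has i.i.d. $N(0,1)$ entries, $W\in\mathbb R^n$ has i.i.d. $N(0,\sigma^2)$ entries, $X$ and $W$ are independent, $\beta^*\in\mathbb R^p$ is deterministic and $Y=X\beta^*+W$. $\log$ is the natural logarithm. $\mathrm{Support}(\beta)=\{i:\beta_i\ne0\}$; $\|\beta\|_0=|\mathrm{Support}(\beta)|$; $\beta$ is $k$-sparse if $\|\beta\|_0\le k$; $|\beta|_{\min}:=\min\{|\beta_i|:\beta_i\neq0\}$. A $k$-sparse vector $\beta\in\mathbb R^p$ is a non-trivial local minimum for $(\tilde\Phi_2)$ if (i) $\mathrm{Support}(\beta)\ne\mathrm{Support}(\beta^* )$, and (ii) every $k$-sparse $\beta_1$ with $\max\{|\mathrm{Support}(\beta)\setminus\mathrm{Support}(\beta_1)|,\ |\mathrm{Support}(\beta_1)\setminus\mathrm{Support}(\beta)|\}\le1$ satisfies $\|Y-X\beta_1\|_2\ge\|Y-X\beta\|_2$.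 "W.h.p. as $k\to+\infty$" means: for every $\varepsilon>0$ there is $k_0$ such that for all choices of the parameters ($n,p,k,\sigma^2,\beta^*$) satisfying the hypotheses with $k\ge k_0$, the stated event has probability at least $1-\varepsilon$. *)

theory Defs
  imports "HOL-Probability.Probability"
begin

text \<open>
  The dimensions \<open>n\<close>, \<open>p\<close> are quantified inside the statement, below the constants \<open>c\<close>, \<open>C\<close>, so they
  cannot be index types. A vector in \<open>\<real>\<^sup>p\<close> is a function \<open>nat \<Rightarrow> real\<close> of which only the coordinates
  \<open>0, \<dots>, p - 1\<close> matter; an \<open>n \<times> p\<close> matrix is a function on pairs of indices, read on
  \<open>{..<n} \<times> {..<p}\<close>. Every notion below ignores the values outside these ranges.
\<close>

definition vec_support :: "nat \<Rightarrow> (nat \<Rightarrow> real) \<Rightarrow> nat set" where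
  "vec_support p \<beta> = {i. i < p \<and> \<beta> i \<noteq> 0}"

definition sparse :: "nat \<Rightarrow> nat \<Rightarrow> (nat \<Rightarrow> real) \<Rightarrow> bool" where
  "sparse p k \<beta> \<longleftrightarrow> card (vec_support p \<beta>) \<le> k"

text \<open>Unspecified (\<open>Min {}\<close>) for the zero vector.\<close>

definition abs_min :: "nat \<Rightarrow> (nat \<Rightarrow> real) \<Rightarrow> real" where
  "abs_min p \<beta> = Min ((\<lambda>i. \<bar>\<beta> i\<bar>) ` vec_support p \<beta>)"

definition mat_vec :: "nat \<Rightarrow> (nat \<times> nat \<Rightarrow> real) \<Rightarrow> (nat \<Rightarrow> real) \<Rightarrow> nat \<Rightarrow> real" where
  "mat_vec p X \<beta> = (\<lambda>i. \<Sum>j<p. X (i, j) * \<beta> j)"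

definition response ::
  "nat \<Rightarrow> (nat \<times> nat \<Rightarrow> real) \<Rightarrow> (nat \<Rightarrow> real) \<Rightarrow> (nat \<Rightarrow> real) \<Rightarrow> nat \<Rightarrow> real" where
  "response p X \<beta>s W = (\<lambda>i. mat_vec p X \<beta>s i + W i)"

definition residual_norm ::
  "nat \<Rightarrow> nat \<Rightarrow> (nat \<times> nat \<Rightarrow> real) \<Rightarrow> (nat \<Rightarrow> real) \<Rightarrow> (nat \<Rightarrow> real) \<Rightarrow> real" where
  "residual_norm n p X Y \<beta> = L2_set (\<lambda>i. Y i - mat_vec p X \<beta> i) {..<n}"

definition nontrivial_local_min ::
  "nat \<Rightarrow> nat \<Rightarrow> nat \<Rightarrow> (nat \<times> nat \<Rightarrow> real) \<Rightarrow> (nat \<Rightarrow> real) \<Rightarrow> (nat \<Rightarrow> real) \<Rightarrow> (nat \<Rightarrow> real) \<Rightarrow> bool"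
where
  "nontrivial_local_min n p k X Y \<beta>s \<beta> \<longleftrightarrow>
     sparse p k \<beta> \<and>
     vec_support p \<beta> \<noteq> vec_support p \<beta>s \<and>
     (\<forall>\<beta>\<^sub>1. sparse p k \<beta>\<^sub>1 \<and>
        max (card (vec_support p \<beta> - vec_support p \<beta>\<^sub>1))
            (card (vec_support p \<beta>\<^sub>1 - vec_support p \<beta>)) \<le> 1 \<longrightarrow>
        residual_norm n p X Y \<beta>\<^sub>1 \<ge> residual_norm n p X Y \<beta>)"

text \<open>
  The joint law of \<open>(X, W)\<close>: all entries of \<open>X\<close> are \<open>N(0, 1)\<close>, all entries of \<open>W\<close> are \<open>N(0, \<sigma>\<^sup>2)\<close>,
  and everything is independent. The probability of an event about \<open>(X, W)\<close> depends only on this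
  law; working with it instead of an arbitrary underlying probability space also prevents the
  constants of the theorem from depending on the type of the sample space. The second argument of
  \<open>normal_density\<close> is the standard deviation.
\<close>

definition gaussian_model ::
  "nat \<Rightarrow> nat \<Rightarrow> real \<Rightarrow> ((nat \<times> nat \<Rightarrow> real) \<times> (nat \<Rightarrow> real)) measure" where
  "gaussian_model n p \<sigma> =
     PiM ({..<n} \<times> {..<p}) (\<lambda>_. density lborel (normal_density 0 1)) \<Otimes>\<^sub>M
     PiM {..<n} (\<lambda>_. density lborel (normal_density 0 \<sigma>))"

end

theory Submission
  imports Defs
begin

text \<open>
  Let \<open>S\<close> be the support of \<open>\<beta>\<^sup>*\<close>. The proof first moves part of the noise into the signal.
  Write \<open>W = X\<^sub>S t + Z\<close> with \<open>Z\<close> orthogonal to the columns of \<open>S\<close>; then \<open>Y = X \<theta> + Z\<close>, where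
  \<open>\<theta> = \<beta>\<^sup>* + t\<close> is supported in \<open>S\<close>. Fix an \<open>X\<close> that is a near isometry on \<open>2k\<close>-sparse vectors. Each
  \<open>t\<^sub>i\<close> and each \<open>\<langle>X\<^sub>j, Z\<rangle>\<close> is a linear form of \<open>W\<close>, hence normal, with standard deviations of order at
  most \<open>\<sigma> / sqrt n\<close> and \<open>\<sigma> sqrt n\<close>. Since \<open>n / \<sigma>\<^sup>2\<close> is at least a large multiple of \<open>ln p\<close>, a union
  bound over these \<open>O(p)\<close> forms gives \<open>\<bar>t\<^sub>i\<bar> < 1/2\<close> and \<open>\<bar>\<langle>X\<^sub>j, Z\<rangle>\<bar> \<le> n / 20\<close> with high
  probability (\<open>RIP_local_min_prob_le\<close>). So the new signal is still bounded away from zero on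
  \<open>S\<close>, and the new noise is invisible to the columns of \<open>S\<close> and nearly so to the others. The
  orthogonality matters: a candidate \<open>\<beta>\<close> may differ from \<open>\<theta>\<close> in all coordinates of \<open>S\<close>, and
  bounding the noise along all of them would lose a factor that depends on \<open>k\<close>.

  The next step is deterministic (\<open>no_nontrivial_local_min_deterministic\<close>). Suppose that \<open>\<beta>\<close> is a
  local minimum with the wrong support. Its residual is orthogonal to the columns in its support, so the
  error of \<open>\<beta>\<close> outside the missing indices is small. Average over all swaps of a wrong index for
  a missing one: the cost is then about \<open>n\<close> times the mean square of the missing coefficients,
  and the gain about twice that. Hence some swap decreases the residual.

  The isometry property holds with high probability because for fixed \<open>z\<close> the quantity \<open>\<parallel>Xz\<parallel>\<^sup>2\<close>
  is a multiple of a \<open>\<chi>\<^sup>2\<close>-variable with \<open>n\<close> degrees of freedom. Its deviation probability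
  \<open>exp (- n / 6400)\<close> beats the \<open>p\<^bsup>O(k)\<^esup>\<close> points of an integer grid so fine that rounding to it
  is essentially exact (\<open>gaussian_matrix_RIP\<close>).

  Finally, the event quantifies over all real vectors, and its measurability is deduced from
  compactness and separability (\<open>sets_Collect_nontrivial_local_min\<close>).
\<close>

section \<open>Inner products, columns and residuals\<close>

definition ip :: "nat \<Rightarrow> (nat \<Rightarrow> real) \<Rightarrow> (nat \<Rightarrow> real) \<Rightarrow> real" where
  "ip n x y = (\<Sum>i<n. x i * y i)"

definition col :: "(nat \<times> nat \<Rightarrow> real) \<Rightarrow> nat \<Rightarrow> nat \<Rightarrow> real" where
  "col X j = (\<lambda>i. X (i, j))"

definition restr :: "nat set \<Rightarrow> (nat \<Rightarrow> real) \<Rightarrow> nat \<Rightarrow> real" where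
  "restr T u = (\<lambda>j. if j \<in> T then u j else 0)"

lemma ip_commute: "ip n x y = ip n y x"
  by (simp add: ip_def mult.commute)

lemma ip_add_left: "ip n (\<lambda>i. x i + y i) z = ip n x z + ip n y z"
  by (simp add: ip_def sum.distrib algebra_simps)

lemma ip_diff_left: "ip n (\<lambda>i. x i - y i) z = ip n x z - ip n y z"
  by (simp add: ip_def sum_subtractf algebra_simps)

lemma ip_scale_left: "ip n (\<lambda>i. c * x i) z = c * ip n x z"
  by (simp add: ip_def sum_distrib_left mult.assoc)

lemma ip_add_right: "ip n z (\<lambda>i. x i + y i) = ip n z x + ip n z y"
  by (simp add: ip_def sum.distrib algebra_simps)

lemma ip_diff_right: "ip n z (\<lambda>i. x i - y i) = ip n z x - ip n z y"
  by (simp add: ip_def sum_subtractf algebra_simps)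

lemma ip_scale_right: "ip n z (\<lambda>i. c * x i) = c * ip n z x"
  by (simp add: ip_def sum_distrib_left mult.left_commute)

lemmas ip_linear = ip_add_left ip_diff_left ip_scale_left ip_add_right ip_diff_right ip_scale_right

lemma ip_self_nonneg: "0 \<le> ip n x x"
  by (simp add: ip_def sum_nonneg)

lemma ip_self_zero: "ip n x x = 0 \<Longrightarrow> ip n x y = 0"
  unfolding ip_def by (subst (asm) sum_nonneg_eq_0_iff) auto

lemma ip_self_eq_power2: "ip n x x = (\<Sum>i<n. (x i)\<^sup>2)"
  by (simp add: ip_def power2_eq_square)

lemma ip_restr:
  assumes "T \<subseteq> {..<p}"
  shows "ip p (restr T u) v = (\<Sum>j\<in>T. u j * v j)"
proof -
  have "ip p (restr T u) v = (\<Sum>j<p. if j \<in> T then u j * v j else 0)"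
    unfolding ip_def restr_def by (intro sum.cong) auto
  also have "\<dots> = (\<Sum>j\<in>{..<p} \<inter> T. u j * v j)"
    by (simp add: sum.inter_restrict)
  also have "{..<p} \<inter> T = T" using assms by blast
  finally show ?thesis .
qed

lemma ip_mat_vec_left: "ip n (mat_vec p X u) y = (\<Sum>j<p. u j * ip n (col X j) y)"
  unfolding ip_def mat_vec_def col_def
  by (simp add: sum_distrib_left sum_distrib_right ac_simps, rule sum.swap)

lemma ip_mat_vec_restr:
  assumes "T \<subseteq> {..<p}"
  shows "ip n (mat_vec p X (restr T u)) y = (\<Sum>j\<in>T. u j * ip n (col X j) y)"
  unfolding ip_mat_vec_left using ip_restr[OF assms, of u "\<lambda>j. ip n (col X j) y"]
  by (simp add: ip_def)

lemma mat_vec_add: "mat_vec p X (\<lambda>j. u j + v j) = (\<lambda>i. mat_vec p X u i + mat_vec p X v i)"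
  by (auto simp: mat_vec_def algebra_simps sum.distrib)

lemma mat_vec_diff: "mat_vec p X (\<lambda>j. u j - v j) = (\<lambda>i. mat_vec p X u i - mat_vec p X v i)"
  by (auto simp: mat_vec_def algebra_simps sum_subtractf)

lemma mat_vec_scale: "mat_vec p X (\<lambda>j. c * u j) = (\<lambda>i. c * mat_vec p X u i)"
  by (auto simp: mat_vec_def algebra_simps sum_distrib_left)

lemma mat_vec_null:
  assumes "ip p u u = 0"
  shows "mat_vec p X u = (\<lambda>i. 0)"
proof
  fix i
  have "mat_vec p X u i = ip p u (\<lambda>j. X (i, j))"
    by (simp add: mat_vec_def ip_def mult.commute)
  then show "mat_vec p X u i = 0" using ip_self_zero[OF assms] by simp
qed

lemma mat_vec_update:
  assumes "j < p"
  shows "mat_vec p X (u(j := t)) = (\<lambda>i. mat_vec p X u i + (t - u j) * col X j i)"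
proof
  fix i
  have eq: "(\<Sum>l\<in>{..<p} - {j}. X (i, l) * (u(j := t)) l) = (\<Sum>l\<in>{..<p} - {j}. X (i, l) * u l)"
    by (intro sum.cong) auto
  show "mat_vec p X (u(j := t)) i = mat_vec p X u i + (t - u j) * col X j i"
    unfolding mat_vec_def col_def
    by (subst (1 2) sum.remove[of _ j]) (use assms eq in \<open>auto simp: algebra_simps\<close>)
qed

lemma mat_vec_unit:
  assumes "j < p"
  shows "mat_vec p X (\<lambda>l. if l = j then 1 else 0) = col X j"
proof
  fix i
  have "mat_vec p X (\<lambda>l. if l = j then 1 else 0) i = (\<Sum>l<p. if l = j then X (i, l) else 0)"
    unfolding mat_vec_def by (intro sum.cong) auto
  then show "mat_vec p X (\<lambda>l. if l = j then 1 else 0) i = col X j i"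
    using assms by (simp add: col_def)
qed

lemma ip_unit:
  assumes "j < p"
  shows "ip p (\<lambda>l. if l = j then 1 else 0) u = u j"
proof -
  have "ip p (\<lambda>l. if l = j then 1 else 0) u = (\<Sum>l<p. if l = j then u l else 0)"
    unfolding ip_def by (intro sum.cong) auto
  then show ?thesis using assms by simp
qed

lemma residual_norm_le_iff:
  "residual_norm n p X Y \<beta> \<le> residual_norm n p X Y \<beta>' \<longleftrightarrow>
   ip n (\<lambda>i. Y i - mat_vec p X \<beta> i) (\<lambda>i. Y i - mat_vec p X \<beta> i)
     \<le> ip n (\<lambda>i. Y i - mat_vec p X \<beta>' i) (\<lambda>i. Y i - mat_vec p X \<beta>' i)"
  by (simp add: residual_norm_def L2_set_def ip_self_eq_power2)

lemma finite_vec_support [simp]: "finite (vec_support p u)"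
  by (simp add: vec_support_def)

lemma vec_support_restr: "vec_support p (restr T u) = T \<inter> vec_support p u"
  by (auto simp: vec_support_def restr_def)

section \<open>Orthogonal projection onto the span of some columns\<close>

text \<open>Gram--Schmidt, one vector at a time. The division below is harmless when \<open>u\<close> is the
  zero vector, because then \<open>V j\<close> already lies in the span of the other vectors.\<close>

lemma orthogonal_projection_exists:
  fixes V :: "nat \<Rightarrow> nat \<Rightarrow> real"
  assumes "finite T"
  shows "\<exists>a. \<forall>j\<in>T. ip n (\<lambda>i. y i - (\<Sum>l\<in>T. a l * V l i)) (V j) = 0"
  using assms
proof (induction T arbitrary: y rule: finite_induct)
  case empty
  show ?case by simp
next
  case (insert j T)
  obtain a where a: "\<And>l. l \<in> T \<Longrightarrow> ip n (\<lambda>i. y i - (\<Sum>l\<in>T. a l * V l i)) (V l) = 0"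
    using insert.IH[of y] by blast
  obtain b where b: "\<And>l. l \<in> T \<Longrightarrow> ip n (\<lambda>i. V j i - (\<Sum>l\<in>T. b l * V l i)) (V l) = 0"
    using insert.IH[of "V j"] by blast
  define y' where "y' = (\<lambda>i. y i - (\<Sum>l\<in>T. a l * V l i))"
  define u where "u = (\<lambda>i. V j i - (\<Sum>l\<in>T. b l * V l i))"
  define c where "c = ip n y' u / ip n u u"
  define a' where "a' = (\<lambda>l. if l = j then c else a l - c * b l)"
  have sum_b: "ip n z (\<lambda>i. \<Sum>l\<in>T. b l * V l i) = (\<Sum>l\<in>T. b l * ip n z (V l))" for z
    unfolding ip_def by (simp add: sum_distrib_left ac_simps, rule sum.swap)
  have Vj: "V j = (\<lambda>i. u i + (\<Sum>l\<in>T. b l * V l i))"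
    by (simp add: u_def)
  have y'T: "ip n y' (V l) = 0" and uT: "ip n u (V l) = 0" if "l \<in> T" for l
    using a[OF that] b[OF that] by (simp_all add: y'_def u_def)
  have y'j: "ip n y' (V j) = ip n y' u" and uj: "ip n u (V j) = ip n u u"
    using y'T uT by (subst Vj, simp add: ip_add_right sum_b)+
  have res: "(\<lambda>i. y i - (\<Sum>l\<in>insert j T. a' l * V l i)) = (\<lambda>i. y' i - c * u i)"
  proof
    fix i
    have "(\<Sum>l\<in>T. a' l * V l i) = (\<Sum>l\<in>T. a l * V l i - c * (b l * V l i))"
      using insert.hyps by (intro sum.cong) (auto simp: a'_def algebra_simps)
    then show "y i - (\<Sum>l\<in>insert j T. a' l * V l i) = y' i - c * u i"
      using insert.hyps
      by (simp add: a'_def y'_def u_def sum_subtractf sum_distrib_left algebra_simps)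
  qed
  have cancel: "ip n y' u = c * ip n u u"
  proof (cases "ip n u u = 0")
    case True
    then have "ip n u y' = 0" by (rule ip_self_zero)
    then show ?thesis using True by (simp add: ip_commute[of n y' u])
  next
    case False
    then show ?thesis by (simp add: c_def)
  qed
  have "\<forall>l\<in>insert j T. ip n (\<lambda>i. y i - (\<Sum>l\<in>insert j T. a' l * V l i)) (V l) = 0"
    unfolding res by (auto simp: ip_linear y'j uj cancel y'T uT)
  then show ?case by blast
qed

lemma column_projection_exists:
  assumes "T \<subseteq> {..<p}"
  obtains a where "\<And>j. j \<in> T \<Longrightarrow> ip n (\<lambda>i. y i - mat_vec p X (restr T a) i) (col X j) = 0"
proof -
  have fin: "finite T" using assms finite_subset by blast
  have eq: "mat_vec p X (restr T a) i = (\<Sum>l\<in>T. a l * col X l i)" for a i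
    using ip_restr[OF assms, of a "\<lambda>l. X (i, l)"]
    by (simp add: mat_vec_def ip_def col_def mult.commute)
  show ?thesis
    using orthogonal_projection_exists[OF fin, of n y "col X"] that by (auto simp: eq)
qed

section \<open>Restricted isometry rules out nontrivial local minima\<close>

text \<open>The restricted isometry property of order \<open>s\<close>, in squared form and without the usual
  normalization of \<open>X\<close> by \<open>1 / sqrt n\<close>: columns with unit variance entries have squared length about \<open>n\<close>.\<close>

definition RIP :: "nat \<Rightarrow> nat \<Rightarrow> nat \<Rightarrow> real \<Rightarrow> (nat \<times> nat \<Rightarrow> real) \<Rightarrow> bool" where
  "RIP n p s \<delta> X \<longleftrightarrow> (\<forall>u. sparse p s u \<longrightarrow>
     (1 - \<delta>) * real n * ip p u u \<le> ip n (mat_vec p X u) (mat_vec p X u) \<and>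
     ip n (mat_vec p X u) (mat_vec p X u) \<le> (1 + \<delta>) * real n * ip p u u)"

lemma RIP_lower:
  "RIP n p s \<delta> X \<Longrightarrow> sparse p s u \<Longrightarrow>
   (1 - \<delta>) * real n * ip p u u \<le> ip n (mat_vec p X u) (mat_vec p X u)"
  by (simp add: RIP_def)

lemma RIP_upper:
  "RIP n p s \<delta> X \<Longrightarrow> sparse p s u \<Longrightarrow>
   ip n (mat_vec p X u) (mat_vec p X u) \<le> (1 + \<delta>) * real n * ip p u u"
  by (simp add: RIP_def)

lemma RIP_column:
  assumes "RIP n p s \<delta> X" "j < p" "s > 0"
  shows "ip n (col X j) (col X j) \<le> (1 + \<delta>) * real n"
proof -
  let ?e = "\<lambda>l. if l = j then 1 else 0 :: real"
  have "vec_support p ?e = {j}" using assms by (auto simp: vec_support_def)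
  then have "sparse p s ?e" using assms by (simp add: sparse_def)
  from RIP_upper[OF assms(1) this] show ?thesis
    using assms by (simp add: mat_vec_unit ip_unit)
qed

text \<open>Polarization: \<open>4\<langle>Xu, Xv\<rangle> = \<parallel>X(u + v)\<parallel>\<^sup>2 - \<parallel>X(u - v)\<parallel>\<^sup>2\<close>, and both arguments on the right
  have squared length \<open>\<parallel>u\<parallel>\<^sup>2 + \<parallel>v\<parallel>\<^sup>2\<close>.\<close>

lemma RIP_almost_orthogonal:
  assumes rip: "RIP n p s \<delta> X" and "ip p u v = 0" "T \<subseteq> {..<p}" "card T \<le> s"
    and "vec_support p u \<subseteq> T" "vec_support p v \<subseteq> T"
  shows "\<bar>ip n (mat_vec p X u) (mat_vec p X v)\<bar> \<le> \<delta> * real n * (ip p u u + ip p v v) / 2"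
proof -
  have fin: "finite T" using assms(3) finite_subset by blast
  have "vec_support p (\<lambda>j. u j + v j) \<subseteq> T" "vec_support p (\<lambda>j. u j - v j) \<subseteq> T"
    using assms(5,6) unfolding vec_support_def by force+
  then have sp: "sparse p s (\<lambda>j. u j + v j)" "sparse p s (\<lambda>j. u j - v j)"
    using fin assms(4) unfolding sparse_def by (meson card_mono order_trans)+
  have vu: "ip p v u = 0" using assms(2) by (simp add: ip_commute)
  have sym: "ip n (mat_vec p X v) (mat_vec p X u) = ip n (mat_vec p X u) (mat_vec p X v)"
    by (rule ip_commute)
  note a = RIP_lower[OF rip sp(1)] RIP_upper[OF rip sp(1)] RIP_lower[OF rip sp(2)] RIP_upper[OF rip sp(2)]
  note b = a[unfolded mat_vec_add mat_vec_diff ip_linear assms(2) vu sym]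
  show ?thesis
    using b by (simp add: abs_le_iff algebra_simps)
qed

lemma quadratic_nonneg_imp_linear_zero:
  fixes a b :: real
  assumes "\<And>t. 0 \<le> a * t\<^sup>2 - 2 * b * t"
  shows "b = 0"
proof (rule ccontr)
  assume b: "b \<noteq> 0"
  define d where "d = \<bar>a\<bar> + 1"
  have d: "d > 0" "a < d" by (auto simp: d_def)
  \<comment> \<open>\<open>d\<close> exceeds \<open>a\<close>, so that the value at \<open>t = b / d\<close> is negative.\<close>
  have "0 \<le> a * (b / d)\<^sup>2 - 2 * b * (b / d)" by (rule assms)
  then have "0 \<le> (a * (b / d)\<^sup>2 - 2 * b * (b / d)) * d\<^sup>2" by simp
  also have "\<dots> = b\<^sup>2 * (a - 2 * d)" using d by (simp add: field_simps power2_eq_square)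
  finally have "0 \<le> b\<^sup>2 * (a - 2 * d)" .
  moreover have "b\<^sup>2 * (a - 2 * d) < 0" using b d by (intro mult_pos_neg) auto
  ultimately show False by simp
qed

text \<open>Changing one coordinate inside the support, or adding one when the support has fewer than \<open>k\<close>
  elements, is an admissible move of any size. Hence the objective is stationary in that
  coordinate, which says that the residual is orthogonal to the column.\<close>

lemma sparse_moves_imp_stationary:
  assumes min: "nontrivial_local_min n p k X Y \<beta>s \<beta>" and r: "r = (\<lambda>i. Y i - mat_vec p X \<beta> i)"
    and j: "j < p" "j \<in> vec_support p \<beta> \<or> card (vec_support p \<beta>) < k"
  shows "ip n (col X j) r = 0"
proof (rule quadratic_nonneg_imp_linear_zero)
  fix t :: real
  define \<beta>1 where "\<beta>1 = \<beta>(j := \<beta> j + t)"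
  let ?S = "vec_support p \<beta>" and ?S1 = "vec_support p \<beta>1"
  have sub: "?S1 \<subseteq> insert j ?S" and "?S - ?S1 \<subseteq> {j}" "?S1 - ?S \<subseteq> {j}"
    by (auto simp: vec_support_def \<beta>1_def split: if_splits)
  then have "card (?S - ?S1) \<le> 1" "card (?S1 - ?S) \<le> 1"
    using card_mono[of "{j}"] by fastforce+
  moreover have "card ?S1 \<le> k"
  proof -
    have "card (insert j ?S) \<le> k"
      using j(2) min by (auto simp: nontrivial_local_min_def sparse_def insert_absorb card_insert_if)
    moreover have "card ?S1 \<le> card (insert j ?S)"
      using sub by (intro card_mono) auto
    ultimately show ?thesis by simp
  qed
  ultimately have "residual_norm n p X Y \<beta> \<le> residual_norm n p X Y \<beta>1"
    using min by (auto simp: nontrivial_local_min_def sparse_def)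
  moreover have "(\<lambda>i. Y i - mat_vec p X \<beta>1 i) = (\<lambda>i. r i - t * col X j i)"
    using j(1) by (auto simp: r \<beta>1_def mat_vec_update)
  ultimately have "ip n r r \<le> ip n (\<lambda>i. r i - t * col X j i) (\<lambda>i. r i - t * col X j i)"
    unfolding residual_norm_le_iff by (simp add: r)
  moreover have "ip n r (col X j) = ip n (col X j) r" by (rule ip_commute)
  ultimately show "0 \<le> ip n (col X j) (col X j) * t\<^sup>2 - 2 * ip n (col X j) r * t"
    by (simp add: ip_linear power2_eq_square algebra_simps)
qed

text \<open>The move that deletes \<open>j\<close> and inserts \<open>i\<close> with value \<open>t\<close> replaces the residual \<open>r\<close> by
  \<open>r + \<beta>\<^sub>j X\<^sub>j - t X\<^sub>i\<close>; the inequality is its expanded square, in which the term with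
  \<open>\<langle>r, X\<^sub>j\<rangle>\<close> vanishes by stationarity.\<close>

lemma swap_move_inequality:
  assumes min: "nontrivial_local_min n p k X Y \<beta>s \<beta>" and r: "r = (\<lambda>i. Y i - mat_vec p X \<beta> i)"
    and j: "j \<in> vec_support p \<beta>" and i: "i < p" "i \<notin> vec_support p \<beta>" and t: "t \<noteq> 0"
  shows "0 \<le> (\<beta> j)\<^sup>2 * ip n (col X j) (col X j) + t\<^sup>2 * ip n (col X i) (col X i)
            - 2 * t * ip n (col X i) r - 2 * t * \<beta> j * ip n (col X j) (col X i)"
proof -
  have jp: "j < p" and ji: "j \<noteq> i" using i j by (auto simp: vec_support_def)
  define \<beta>1 where "\<beta>1 = \<beta>(j := 0, i := t)"
  let ?S = "vec_support p \<beta>" and ?S1 = "vec_support p \<beta>1"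
  have S1: "?S1 = insert i (?S - {j})"
    using i t ji by (auto simp: vec_support_def \<beta>1_def)
  have "?S - ?S1 = {j}" "?S1 - ?S = {i}" using S1 i j ji by auto
  moreover have "card ?S1 = card ?S"
    unfolding S1 using i j card_Suc_Diff1[OF _ j] by (simp add: card_insert_if)
  ultimately have "residual_norm n p X Y \<beta> \<le> residual_norm n p X Y \<beta>1"
    using min by (auto simp: nontrivial_local_min_def sparse_def)
  moreover have "(\<lambda>l. Y l - mat_vec p X \<beta>1 l) = (\<lambda>l. r l + (\<beta> j * col X j l - t * col X i l))"
    using jp i(1) i(2) ji by (auto simp: r \<beta>1_def mat_vec_update vec_support_def)
  ultimately have *: "ip n r r \<le> ip n (\<lambda>l. r l + (\<beta> j * col X j l - t * col X i l))
                            (\<lambda>l. r l + (\<beta> j * col X j l - t * col X i l))"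
    unfolding residual_norm_le_iff by (simp add: r)
  have "ip n (col X j) r = 0"
    using sparse_moves_imp_stationary[OF min r jp] j by blast
  moreover have "ip n r (col X j) = ip n (col X j) r" "ip n r (col X i) = ip n (col X i) r"
    "ip n (col X i) (col X j) = ip n (col X j) (col X i)"
    by (rule ip_commute)+
  ultimately show ?thesis using *[unfolded ip_linear]
    by (simp add: power2_eq_square algebra_simps)
qed

text \<open>The deterministic core. Write \<open>A\<close> for the wrong and \<open>B\<close> for the missing indices, \<open>h = \<theta> - \<beta>\<close>,
  \<open>b\<close> for its part on \<open>B\<close> and \<open>g\<close> for the rest, so that the residual is \<open>r = Xh + Z\<close>.

  If the support of \<open>\<beta>\<close> has fewer than \<open>k\<close> elements, then \<open>r\<close> is orthogonal to every column, so
  \<open>\<parallel>Xh\<parallel>\<^sup>2 = - \<langle>Xh, Z\<rangle>\<close>. The left side is about \<open>n \<parallel>h\<parallel>\<^sup>2\<close>, the right side at most \<open>n \<parallel>h\<parallel>\<^sup>2 / 20\<close>.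

  Otherwise \<open>\<bar>A\<bar> = \<bar>B\<bar>\<close>. Orthogonality of \<open>r\<close> to \<open>Xg\<close> shows that the interference \<open>g\<close> is small compared
  with \<open>b\<close>. Now average the inequality of the swap that deletes \<open>j \<in> A\<close> and inserts \<open>i \<in> B\<close> with
  value \<open>b\<^sub>i\<close> over all pairs \<open>(j, i)\<close>: per unit of \<open>n \<parallel>b\<parallel>\<^sup>2\<close>, the deletions and the squares of the
  inserted columns cost little more than \<open>1\<close>, while the correlation with the residual gains
  almost \<open>2\<close>. So some swap decreases the residual.

  The noise is harmless for two reasons. It is orthogonal to the columns of the true support, so
  only the coefficients on \<open>A\<close> meet it; and the total of \<open>\<bar>\<beta>\<^sub>j\<bar>\<close> over \<open>A\<close> is at most
  \<open>\<parallel>g\<parallel>\<^sup>2 + \<bar>A\<bar> / 4 \<le> \<parallel>g\<parallel>\<^sup>2 + \<parallel>b\<parallel>\<^sup>2\<close>, because the missing coefficients are at least \<open>1/2\<close> in absolute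
  value. Working with squares like this avoids all square roots.\<close>

lemma no_nontrivial_local_min_deterministic:
  fixes \<theta> Z Y :: "nat \<Rightarrow> real"
  assumes rip: "RIP n p (2 * k) (1/10) X" and n: "n > 0"
    and Y: "Y = (\<lambda>i. mat_vec p X \<theta> i + Z i)"
    and supp: "vec_support p \<theta> = vec_support p \<beta>s" "card (vec_support p \<beta>s) = k"
    and large: "\<And>j. j \<in> vec_support p \<beta>s \<Longrightarrow> 1/2 \<le> \<bar>\<theta> j\<bar>"
    and orth: "\<And>j. j \<in> vec_support p \<beta>s \<Longrightarrow> ip n (col X j) Z = 0"
    and noise: "\<And>j. j < p \<Longrightarrow> \<bar>ip n (col X j) Z\<bar> \<le> real n / 20"
  shows "\<not> nontrivial_local_min n p k X Y \<beta>s \<beta>"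
proof
  assume min: "nontrivial_local_min n p k X Y \<beta>s \<beta>"
  define Ss where "Ss = vec_support p \<beta>s"
  define S where "S = vec_support p \<beta>"
  define A where "A = S - Ss"
  define B where "B = Ss - S"
  define r where "r = (\<lambda>i. Y i - mat_vec p X \<beta> i)"
  define h where "h = (\<lambda>j. \<theta> j - \<beta> j)"
  define b where "b = restr B h"
  define g where "g = (\<lambda>j. h j - b j)"
  have fin: "finite S" "finite Ss" "finite A" "finite B"
    by (auto simp: S_def Ss_def A_def B_def)
  have subp: "S \<subseteq> {..<p}" "Ss \<subseteq> {..<p}" "A \<subseteq> {..<p}" "B \<subseteq> {..<p}"
    by (auto simp: S_def Ss_def A_def B_def vec_support_def)
  have cardS: "card S \<le> k" and SSs: "S \<noteq> Ss" and cardSs: "card Ss = k"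
    using min supp by (auto simp: nontrivial_local_min_def sparse_def S_def Ss_def)
  have "card A + card (S \<inter> Ss) = card S" "card B + card (S \<inter> Ss) = card Ss"
    unfolding A_def B_def using fin
    by (metis Int_commute card_Int_Diff add.commute)+
  then have cardAB: "card A \<le> card B" and cardAB': "card S = k \<Longrightarrow> card A = card B"
    using cardS cardSs by auto
  have "B \<noteq> {}"
    using SSs cardS cardSs fin unfolding B_def
    by (metis Diff_eq_empty_iff card_seteq)
  then have cardB: "card B > 0" using fin by auto
  have \<theta>0: "\<theta> j = 0" if "j < p" "j \<notin> Ss" for j
    using supp(1) that by (auto simp: vec_support_def Ss_def)
  have \<beta>0: "\<beta> j = 0" if "j < p" "j \<notin> S" for j
    using that by (auto simp: vec_support_def S_def)
  have bB: "b j = \<theta> j" if "j \<in> B" for j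
    using that subp \<beta>0[of j] by (auto simp: b_def restr_def h_def B_def)
  have suppT: "vec_support p h \<subseteq> S \<union> Ss" "vec_support p b \<subseteq> S \<union> Ss" "vec_support p g \<subseteq> S \<union> Ss"
    using \<theta>0 \<beta>0 by (fastforce simp: vec_support_def h_def b_def g_def restr_def split: if_splits)+
  have cardT: "card (S \<union> Ss) \<le> 2 * k"
    using card_Un_le[of S Ss] cardS cardSs by simp
  have sp: "sparse p (2 * k) u" if "vec_support p u \<subseteq> S \<union> Ss" for u
    using that cardT fin unfolding sparse_def by (meson card_mono finite_UnI order_trans)
  have TP: "S \<union> Ss \<subseteq> {..<p}" using subp by auto
  have qb: "ip p b b = (\<Sum>j\<in>B. (\<theta> j)\<^sup>2)"
    using ip_restr[OF subp(4), of h b] by (simp add: b_def[symmetric] power2_eq_square)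
       (intro sum.cong, auto simp: bB, metis bB b_def restr_def)
  have gb: "ip p g b = 0"
    unfolding ip_def g_def b_def restr_def by (intro sum.neutral) auto
  have bg: "ip p b g = 0" using gb by (simp add: ip_commute)
  have qh: "ip p h h = ip p g g + ip p b b"
  proof -
    have "h = (\<lambda>j. g j + b j)" by (simp add: g_def)
    then show ?thesis by (simp add: ip_linear gb bg)
  qed
  have qa: "(\<Sum>j\<in>A. (\<beta> j)\<^sup>2) \<le> ip p g g"
  proof -
    have "(\<Sum>j\<in>A. (\<beta> j)\<^sup>2) = (\<Sum>j\<in>A. g j * g j)"
      using \<theta>0 subp by (intro sum.cong) (auto simp: g_def b_def restr_def h_def A_def B_def power2_eq_square subset_iff)
    also have "\<dots> \<le> ip p g g"
      unfolding ip_def using subp by (intro sum_mono2) auto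
    finally show ?thesis .
  qed
  have mB: "real (card B) / 4 \<le> ip p b b"
  proof -
    have "(\<Sum>j\<in>B. 1/4) \<le> (\<Sum>j\<in>B. (\<theta> j)\<^sup>2)"
    proof (intro sum_mono)
      fix j assume "j \<in> B"
      then have "1/2 \<le> \<bar>\<theta> j\<bar>" using large by (auto simp: B_def Ss_def)
      then have "(1/2)\<^sup>2 \<le> \<bar>\<theta> j\<bar>\<^sup>2" by (intro power_mono) auto
      then show "1/4 \<le> (\<theta> j)\<^sup>2" by (simp add: power_divide)
    qed
    then show ?thesis by (simp add: qb)
  qed
  have qb_pos: "ip p b b > 0" using mB cardB by (smt (verit) divide_pos_pos of_nat_0_less_iff)
  \<comment> \<open>Columns of the true support are orthogonal to the noise, so only \<open>A\<close> contributes.\<close>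
  have noiseX: "\<bar>ip n (mat_vec p X u) Z\<bar> \<le> real n / 20 * (ip p g g + ip p b b)"
    if u: "\<And>j. j \<in> A \<Longrightarrow> u j = - \<beta> j" "vec_support p u \<subseteq> S \<union> Ss" for u
  proof -
    have "ip n (mat_vec p X u) Z = (\<Sum>j<p. u j * ip n (col X j) Z)"
      by (rule ip_mat_vec_left)
    also have "\<dots> = (\<Sum>j\<in>A. u j * ip n (col X j) Z)"
    proof (intro sum.mono_neutral_right ballI)
      fix j assume "j \<in> {..<p} - A"
      then have "j \<in> Ss \<or> j \<notin> S \<union> Ss" "j < p" by (auto simp: A_def)
      then show "u j * ip n (col X j) Z = 0"
        using u(2) orth by (auto simp: Ss_def vec_support_def)
    qed (use subp in auto)
    also have "\<bar>\<dots>\<bar> \<le> (\<Sum>j\<in>A. real n / 20 * ((\<beta> j)\<^sup>2 + 1/4))"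
    proof (rule order_trans[OF sum_abs], intro sum_mono)
      fix j assume j: "j \<in> A"
      have "0 \<le> (\<bar>\<beta> j\<bar> - 1/2)\<^sup>2" by simp
      then have "\<bar>\<beta> j\<bar> \<le> (\<beta> j)\<^sup>2 + 1/4" by (simp add: power2_eq_square algebra_simps)
      moreover have "\<bar>ip n (col X j) Z\<bar> \<le> real n / 20" using j subp noise by auto
      ultimately have "\<bar>\<beta> j\<bar> * \<bar>ip n (col X j) Z\<bar> \<le> ((\<beta> j)\<^sup>2 + 1/4) * (real n / 20)"
        by (intro mult_mono) auto
      then show "\<bar>u j * ip n (col X j) Z\<bar> \<le> real n / 20 * ((\<beta> j)\<^sup>2 + 1/4)"
        using u(1)[OF j] by (simp add: abs_mult mult.commute)
    qed
    also have "\<dots> = real n / 20 * ((\<Sum>j\<in>A. (\<beta> j)\<^sup>2) + real (card A) / 4)"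
      by (subst sum_distrib_left[symmetric]) (simp add: sum.distrib)
    also have "\<dots> \<le> real n / 20 * (ip p g g + ip p b b)"
      using qa mB cardAB by (intro mult_left_mono add_mono) auto
    finally show ?thesis .
  qed
  have hA: "h j = - \<beta> j" "g j = - \<beta> j" if "j \<in> A" for j
    using that \<theta>0[of j] subp by (auto simp: h_def g_def b_def restr_def A_def B_def subset_iff)
  have noise_h: "\<bar>ip n (mat_vec p X h) Z\<bar> \<le> real n / 20 * (ip p g g + ip p b b)"
    by (rule noiseX) (use hA suppT in auto)
  have noise_g: "\<bar>ip n (mat_vec p X g) Z\<bar> \<le> real n / 20 * (ip p g g + ip p b b)"
    by (rule noiseX) (use hA suppT in auto)
  have r_eq: "r = (\<lambda>i. mat_vec p X h i + Z i)"
    by (simp add: r_def Y h_def mat_vec_diff algebra_simps)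
  have stat: "ip n (col X j) r = 0" if "j < p" "j \<in> S \<or> card S < k" for j
    using sparse_moves_imp_stationary[OF min r_def that(1)] that(2) by (auto simp: S_def)
  show False
  proof (cases "card S = k")
    case False
    then have "ip n (mat_vec p X h) r = 0"
      unfolding ip_mat_vec_left using stat cardS by (intro sum.neutral) auto
    then have "ip n (mat_vec p X h) (mat_vec p X h) \<le> real n / 20 * (ip p g g + ip p b b)"
      using noise_h by (auto simp: r_eq ip_linear)
    moreover have "(1 - 1/10) * real n * (ip p g g + ip p b b) \<le> ip n (mat_vec p X h) (mat_vec p X h)"
      using RIP_lower[OF rip sp[OF suppT(1)]] qh by simp
    moreover have "real n * (ip p g g + ip p b b) > 0"
      using n qb_pos ip_self_nonneg[of p g] by simp
    ultimately show False by (simp add: algebra_simps)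
  next
    case True
    note cardA = cardAB'[OF True]
    define m where "m = real (card B)"
    have m: "m \<ge> 1" using cardB by (simp add: m_def)
    have orth_g: "ip n (mat_vec p X g) r = 0"
      unfolding ip_mat_vec_left
    proof (intro sum.neutral ballI)
      fix j assume j: "j \<in> {..<p}"
      show "g j * ip n (col X j) r = 0"
      proof (cases "j \<in> S")
        case True then show ?thesis using stat j by auto
      next
        case False
        then have "g j = 0" using suppT(3) j \<theta>0[of j] \<beta>0[of j]
          by (cases "j \<in> Ss") (auto simp: g_def b_def restr_def B_def h_def)
        then show ?thesis by simp
      qed
    qed
    have Xh: "mat_vec p X h = (\<lambda>i. mat_vec p X g i + mat_vec p X b i)"
      using mat_vec_add[of p X g b] by (simp add: g_def)
    let ?gb = "ip n (mat_vec p X g) (mat_vec p X b)"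
    have gb_small: "\<bar>?gb\<bar> \<le> real n / 20 * (ip p g g + ip p b b)"
      using RIP_almost_orthogonal[OF rip gb TP cardT suppT(3,2)] by simp
    \<comment> \<open>Orthogonality of the residual to \<open>Xg\<close> forces \<open>g\<close> to be small relative to \<open>b\<close>.\<close>
    have "ip n (mat_vec p X g) (mat_vec p X g) = - ?gb - ip n (mat_vec p X g) Z"
      using orth_g by (simp add: r_eq Xh ip_linear)
    moreover have "(1 - 1/10) * real n * ip p g g \<le> ip n (mat_vec p X g) (mat_vec p X g)"
      by (rule RIP_lower[OF rip sp[OF suppT(3)]])
    ultimately have "real n * (8 * ip p g g) \<le> real n * ip p b b"
      using gb_small noise_g by (simp add: algebra_simps)
    then have g_small: "8 * ip p g g \<le> ip p b b" using n by simp
    let ?c = "\<lambda>j. ip n (col X j) (col X j)"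
    have swap: "0 \<le> (\<beta> j)\<^sup>2 * ?c j + (b i)\<^sup>2 * ?c i - 2 * b i * ip n (col X i) r
                   - 2 * b i * \<beta> j * ip n (col X j) (col X i)" if "j \<in> A" "i \<in> B" for i j
    proof (rule swap_move_inequality[OF min r_def])
      have "1/2 \<le> \<bar>b i\<bar>" using large[of i] that bB by (auto simp: B_def Ss_def)
      then show "b i \<noteq> 0" by auto
    qed (use that subp in \<open>auto simp: A_def B_def S_def\<close>)
    have col_le: "?c j \<le> 11/10 * real n" if "j < p" for j
      using RIP_column[OF rip that] cardB cardSs card_mono[of Ss B] fin by (auto simp: B_def)
    have cross: "(\<Sum>j\<in>A. \<Sum>i\<in>B. b i * \<beta> j * ip n (col X j) (col X i))
                  = ip n (mat_vec p X (restr A \<beta>)) (mat_vec p X b)"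
    proof -
      have "b = restr B b" by (auto simp: b_def restr_def)
      then have "ip n (mat_vec p X b) y = (\<Sum>i\<in>B. b i * ip n (col X i) y)" for y
        using ip_mat_vec_restr[OF subp(4), of n X b y] by metis
      then have "ip n (col X j) (mat_vec p X b) = (\<Sum>i\<in>B. b i * ip n (col X j) (col X i))" for j
        by (metis (no_types, lifting) ip_commute sum.cong)
      then show ?thesis
        by (simp add: ip_mat_vec_restr[OF subp(3)] sum_distrib_left ac_simps)
    qed
    have qA: "ip p (restr A \<beta>) (restr A \<beta>) = (\<Sum>j\<in>A. (\<beta> j)\<^sup>2)"
      using ip_restr[OF subp(3), of \<beta> "restr A \<beta>"] by (simp add: restr_def power2_eq_square)
    have cross_small: "\<bar>ip n (mat_vec p X (restr A \<beta>)) (mat_vec p X b)\<bar> \<le> real n / 20 * (ip p g g + ip p b b)"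
    proof -
      have "ip p (restr A \<beta>) b = 0"
        unfolding ip_def b_def restr_def by (intro sum.neutral) (auto simp: A_def B_def)
      moreover have "vec_support p (restr A \<beta>) \<subseteq> S \<union> Ss"
        by (auto simp: vec_support_restr A_def)
      ultimately have "\<bar>ip n (mat_vec p X (restr A \<beta>)) (mat_vec p X b)\<bar>
          \<le> 1/10 * real n * ((\<Sum>j\<in>A. (\<beta> j)\<^sup>2) + ip p b b) / 2"
        using RIP_almost_orthogonal[OF rip _ TP cardT _ suppT(2)] qA by metis
      also have "\<dots> \<le> real n / 20 * (ip p g g + ip p b b)"
        using qa n by (auto intro!: mult_left_mono)
      finally show ?thesis .
    qed
    have rb: "(\<Sum>i\<in>B. b i * ip n (col X i) r) = ip n (mat_vec p X h) r"
    proof -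
      have "(\<Sum>i\<in>B. b i * ip n (col X i) r) = ip n (mat_vec p X b) r"
        unfolding b_def ip_mat_vec_restr[OF subp(4)] by (intro sum.cong) (auto simp: restr_def)
      also have "\<dots> = ip n (mat_vec p X h) r" by (simp add: Xh ip_linear orth_g)
      finally show ?thesis .
    qed
    have "0 \<le> (\<Sum>j\<in>A. \<Sum>i\<in>B. (\<beta> j)\<^sup>2 * ?c j + (b i)\<^sup>2 * ?c i - 2 * b i * ip n (col X i) r
                   - 2 * b i * \<beta> j * ip n (col X j) (col X i))"
      by (intro sum_nonneg swap)
    also have "\<dots> = m * (\<Sum>j\<in>A. (\<beta> j)\<^sup>2 * ?c j) + m * (\<Sum>i\<in>B. (b i)\<^sup>2 * ?c i)
          - 2 * m * ip n (mat_vec p X h) r - 2 * ip n (mat_vec p X (restr A \<beta>)) (mat_vec p X b)"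
      unfolding cross[symmetric] rb[symmetric] m_def using cardA
      by (simp add: sum.distrib sum_subtractf sum_distrib_left ac_simps)
    finally have main: "0 \<le> \<dots>" .
    have sA: "(\<Sum>j\<in>A. (\<beta> j)\<^sup>2 * ?c j) \<le> 11/10 * real n * ip p g g"
    proof -
      have "(\<Sum>j\<in>A. (\<beta> j)\<^sup>2 * ?c j) \<le> (\<Sum>j\<in>A. (\<beta> j)\<^sup>2 * (11/10 * real n))"
        using col_le subp by (intro sum_mono mult_left_mono) auto
      also have "\<dots> = 11/10 * real n * (\<Sum>j\<in>A. (\<beta> j)\<^sup>2)"
        by (simp add: sum_distrib_left ac_simps)
      also have "\<dots> \<le> 11/10 * real n * ip p g g"
        using qa by (intro mult_left_mono) auto
      finally show ?thesis .
    qed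
    have sB: "(\<Sum>i\<in>B. (b i)\<^sup>2 * ?c i) \<le> 11/10 * real n * ip p b b"
    proof -
      have "(\<Sum>i\<in>B. (b i)\<^sup>2 * ?c i) \<le> (\<Sum>i\<in>B. (b i)\<^sup>2 * (11/10 * real n))"
        using col_le subp by (intro sum_mono mult_left_mono) auto
      also have "\<dots> = 11/10 * real n * ip p b b"
        by (simp add: sum_distrib_left qb bB ac_simps)
      finally show ?thesis .
    qed
    have sr: "17/20 * (real n * (ip p g g + ip p b b)) \<le> ip n (mat_vec p X h) r"
      using RIP_lower[OF rip sp[OF suppT(1)]] noise_h by (simp add: r_eq ip_linear qh)
    \<comment> \<open>In units of \<open>G\<close> the costs are \<open>11/10 + 1/10\<close> (swaps and cross term), the gain is \<open>17/10\<close>.\<close>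
    define G where "G = m * (real n * (ip p g g + ip p b b))"
    have "m * (\<Sum>j\<in>A. (\<beta> j)\<^sup>2 * ?c j) + m * (\<Sum>i\<in>B. (b i)\<^sup>2 * ?c i) \<le> 11/10 * G"
      using mult_left_mono[OF add_mono[OF sA sB], of m] m by (simp add: G_def algebra_simps)
    moreover have "17/20 * G \<le> m * ip n (mat_vec p X h) r"
      using mult_left_mono[OF sr, of m] m by (simp add: G_def algebra_simps)
    moreover have "\<bar>ip n (mat_vec p X (restr A \<beta>)) (mat_vec p X b)\<bar> \<le> G / 20"
    proof -
      have "1 * (real n * (ip p g g + ip p b b)) \<le> G"
        unfolding G_def using m ip_self_nonneg[of p] by (intro mult_right_mono) auto
      then show ?thesis using cross_small by linarith
    qed
    ultimately have "G \<le> 0" using main by linarith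
    moreover have "G > 0"
      unfolding G_def using m n qb_pos ip_self_nonneg[of p g] by (intro mult_pos_pos) auto
    ultimately show False by simp
  qed
qed

section \<open>Gaussian tail bounds\<close>

abbreviation normal_measure :: "real \<Rightarrow> real measure" where
  "normal_measure \<sigma> \<equiv> density lborel (normal_density 0 \<sigma>)"

lemma nn_integral_normal_density: "\<sigma> > 0 \<Longrightarrow> (\<integral>\<^sup>+x. ennreal (normal_density \<mu> \<sigma> x) \<partial>lborel) = 1"
  using nn_integral_eq_integral[OF integrable_normal_density[of \<sigma> \<mu>]]
  by simp

text \<open>Completing the square: the exponential tilt of a centred normal density is a multiple of a
  shifted one.\<close>

lemma nn_integral_normal_exp_linear:
  assumes "\<sigma> > 0"
  shows "(\<integral>\<^sup>+x. ennreal (exp (a * x)) \<partial>normal_measure \<sigma>) = ennreal (exp (a\<^sup>2 * \<sigma>\<^sup>2 / 2))"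
proof -
  have "normal_density 0 \<sigma> x * exp (a * x) = exp (a\<^sup>2 * \<sigma>\<^sup>2 / 2) * normal_density (a * \<sigma>\<^sup>2) \<sigma> x" for x
    using assms by (simp add: normal_density_def mult_exp_exp)
       (simp add: field_simps power2_eq_square)
  then have "(\<integral>\<^sup>+x. ennreal (exp (a * x)) \<partial>normal_measure \<sigma>)
      = (\<integral>\<^sup>+x. ennreal (exp (a\<^sup>2 * \<sigma>\<^sup>2 / 2)) * ennreal (normal_density (a * \<sigma>\<^sup>2) \<sigma> x) \<partial>lborel)"
    by (subst nn_integral_density) (auto simp flip: ennreal_mult)
  also have "\<dots> = ennreal (exp (a\<^sup>2 * \<sigma>\<^sup>2 / 2))"
    using assms by (subst nn_integral_cmult) (auto simp: nn_integral_normal_density)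
  finally show ?thesis .
qed

text \<open>The tilted density is a multiple of a normal density with another variance.\<close>

lemma nn_integral_normal_exp_square:
  assumes "s > 0" "2 * l * s\<^sup>2 < 1"
  shows "(\<integral>\<^sup>+x. ennreal (exp (l * x\<^sup>2)) * ennreal (normal_density 0 s x) \<partial>lborel)
    = ennreal (1 / sqrt (1 - 2 * l * s\<^sup>2))"
proof -
  define d where "d = sqrt (1 - 2 * l * s\<^sup>2)"
  have d: "d > 0" "d\<^sup>2 = 1 - 2 * l * s\<^sup>2" using assms by (auto simp: d_def)
  have l: "l = (1 - d\<^sup>2) / (2 * s\<^sup>2)" using d assms by (simp add: field_simps)
  have "exp (l * x\<^sup>2) * normal_density 0 s x = (1 / d) * normal_density 0 (s / d) x" for x
  proof -
    have e: "l * x\<^sup>2 - x\<^sup>2 / (2 * s\<^sup>2) = - (x\<^sup>2 * d\<^sup>2 / (2 * s\<^sup>2))"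
      using assms(1) unfolding l by (simp add: field_simps)
    have sq: "sqrt (2 * pi * (s / d)\<^sup>2) = sqrt (2 * pi * s\<^sup>2) / d"
    proof -
      have "2 * pi * (s / d)\<^sup>2 = (2 * pi * s\<^sup>2) / d\<^sup>2" by (simp add: power_divide)
      then show ?thesis using d(1) by (simp only: real_sqrt_divide real_sqrt_abs abs_of_pos)
    qed
    have ex: "- (x\<^sup>2) / (2 * (s / d)\<^sup>2) = - (x\<^sup>2 * d\<^sup>2 / (2 * s\<^sup>2))"
      by (simp add: power_divide)
    have "exp (l * x\<^sup>2) * normal_density 0 s x
        = exp (l * x\<^sup>2) * exp (- (x\<^sup>2 / (2 * s\<^sup>2))) / sqrt (2 * pi * s\<^sup>2)"
      by (simp add: normal_density_def)
    also have "\<dots> = exp (- (x\<^sup>2 * d\<^sup>2 / (2 * s\<^sup>2))) / sqrt (2 * pi * s\<^sup>2)"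
      by (simp only: mult_exp_exp e[symmetric]) simp
    also have "\<dots> = (1 / d) * normal_density 0 (s / d) x"
      unfolding normal_density_def diff_0_right sq ex using d(1) by simp
    finally show ?thesis .
  qed
  then have "(\<integral>\<^sup>+x. ennreal (exp (l * x\<^sup>2)) * ennreal (normal_density 0 s x) \<partial>lborel)
      = (\<integral>\<^sup>+x. ennreal (1 / d) * ennreal (normal_density 0 (s / d) x) \<partial>lborel)"
    using d by (simp flip: ennreal_mult)
  also have "\<dots> = ennreal (1 / d)"
    using assms d by (subst nn_integral_cmult) (auto simp: nn_integral_normal_density)
  finally show ?thesis by (simp add: d_def)
qed

text \<open>Chernoff bound; \<open>V\<close> replaces the squared length of \<open>v\<close> so that \<open>v = 0\<close> need not be treated apart.\<close>

lemma gaussian_vector_upper_tail: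
  fixes n :: nat and \<sigma> t V :: real
  defines "M \<equiv> PiM {..<n} (\<lambda>_. normal_measure \<sigma>)"
  assumes "\<sigma> > 0" "V > 0" "t > 0" "ip n v v \<le> V"
  shows "emeasure M {w \<in> space M. t \<le> ip n v w} \<le> ennreal (exp (- (t\<^sup>2 / (2 * \<sigma>\<^sup>2 * V))))"
proof -
  interpret N: prob_space "normal_measure \<sigma>" by (rule prob_space_normal_density) fact
  interpret product_prob_space "\<lambda>_. normal_measure \<sigma>" "{..<n}" ..
  define s where "s = t / (\<sigma>\<^sup>2 * V)"
  have s: "s > 0" using assms by (simp add: s_def)
  have meas [measurable]: "(\<lambda>w. ip n v w) \<in> borel_measurable M"
    unfolding ip_def M_def by measurable
  have "emeasure M {w \<in> space M. t \<le> ip n v w}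
      \<le> ennreal (exp (- s * t)) * (\<integral>\<^sup>+w. ennreal (exp (s * ip n v w)) * indicator (space M) w \<partial>M)"
    by (rule Chernoff_ineq_nn_integral_ge) (use s in auto)
  also have "(\<integral>\<^sup>+w. ennreal (exp (s * ip n v w)) * indicator (space M) w \<partial>M)
      = (\<integral>\<^sup>+w. (\<Prod>i<n. ennreal (exp (s * v i * w i))) \<partial>M)"
    by (intro nn_integral_cong)
      (simp add: ip_def sum_distrib_left exp_sum prod_ennreal mult.assoc)
  also have "\<dots> = (\<Prod>i<n. ennreal (exp ((s * v i)\<^sup>2 * \<sigma>\<^sup>2 / 2)))"
    unfolding M_def using assms
    by (subst product_nn_integral_prod) (auto simp: nn_integral_normal_exp_linear)
  also have "\<dots> = ennreal (exp (s\<^sup>2 * \<sigma>\<^sup>2 / 2 * ip n v v))"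
    by (simp add: prod_ennreal exp_sum[symmetric] ip_self_eq_power2 sum_distrib_left power_mult_distrib ac_simps)
  also have "ennreal (exp (- s * t)) * \<dots> = ennreal (exp (s\<^sup>2 * \<sigma>\<^sup>2 / 2 * ip n v v - s * t))"
    by (simp add: ennreal_mult[symmetric] mult_exp_exp)
  also have "\<dots> \<le> ennreal (exp (- (t\<^sup>2 / (2 * \<sigma>\<^sup>2 * V))))"
  proof (intro ennreal_leI, simp only: exp_le_cancel_iff)
    have "s\<^sup>2 * \<sigma>\<^sup>2 / 2 * ip n v v \<le> s\<^sup>2 * \<sigma>\<^sup>2 / 2 * V"
      using assms by (intro mult_left_mono) auto
    also have "\<dots> - s * t = - (t\<^sup>2 / (2 * \<sigma>\<^sup>2 * V))"
      using assms by (simp add: s_def field_simps power2_eq_square)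
    finally show "s\<^sup>2 * \<sigma>\<^sup>2 / 2 * ip n v v - s * t \<le> - (t\<^sup>2 / (2 * \<sigma>\<^sup>2 * V))" by simp
  qed
  finally show ?thesis .
qed

lemma gaussian_vector_tail:
  fixes n :: nat and \<sigma> t V :: real
  defines "M \<equiv> PiM {..<n} (\<lambda>_. normal_measure \<sigma>)"
  assumes "\<sigma> > 0" "V > 0" "t > 0" "ip n v v \<le> V"
  shows "{w \<in> space M. t \<le> \<bar>ip n v w\<bar>} \<in> sets M"
    and "emeasure M {w \<in> space M. t \<le> \<bar>ip n v w\<bar>} \<le> ennreal (2 * exp (- (t\<^sup>2 / (2 * \<sigma>\<^sup>2 * V))))"
proof -
  have meas [measurable]: "(\<lambda>w. ip n v w) \<in> borel_measurable M" for v
    unfolding ip_def M_def by measurable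
  show "{w \<in> space M. t \<le> \<bar>ip n v w\<bar>} \<in> sets M" by measurable
  have neg: "ip n (\<lambda>i. - v i) w = - ip n v w" for w
    using ip_scale_left[of n "-1" v w] by simp
  have "ip n (\<lambda>i. - v i) (\<lambda>i. - v i) \<le> V" using assms by (simp add: ip_def)
  note tails = gaussian_vector_upper_tail[OF assms(2-5)] gaussian_vector_upper_tail[OF assms(2-4) this]
  have "{w \<in> space M. t \<le> \<bar>ip n v w\<bar>}
      = {w \<in> space M. t \<le> ip n v w} \<union> {w \<in> space M. t \<le> ip n (\<lambda>i. - v i) w}"
    unfolding neg by (auto simp: abs_if)
  also have "emeasure M \<dots> \<le> emeasure M {w \<in> space M. t \<le> ip n v w}
      + emeasure M {w \<in> space M. t \<le> ip n (\<lambda>i. - v i) w}"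
    by (rule emeasure_subadditive) measurable
  also have "\<dots> \<le> ennreal (exp (- (t\<^sup>2 / (2 * \<sigma>\<^sup>2 * V)))) + ennreal (exp (- (t\<^sup>2 / (2 * \<sigma>\<^sup>2 * V))))"
    unfolding M_def by (intro add_mono tails)
  also have "\<dots> = ennreal (2 * exp (- (t\<^sup>2 / (2 * \<sigma>\<^sup>2 * V))))"
    by (subst ennreal_plus[symmetric]) auto
  finally show "emeasure M {w \<in> space M. t \<le> \<bar>ip n v w\<bar>} \<le> \<dots>" .
qed

abbreviation gaussian_matrix :: "nat \<Rightarrow> nat \<Rightarrow> (nat \<times> nat \<Rightarrow> real) measure" where
  "gaussian_matrix n p \<equiv> PiM ({..<n} \<times> {..<p}) (\<lambda>_. normal_measure 1)"

lemma prob_space_gaussian_matrix: "prob_space (gaussian_matrix n p)"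
  by (intro prob_space_PiM prob_space_normal_density) simp

lemma indep_vars_gaussian_matrix:
  assumes "n > 0" "p > 0"
  shows "prob_space.indep_vars (gaussian_matrix n p) (\<lambda>_. borel) (\<lambda>ij X. X ij) ({..<n} \<times> {..<p})"
proof -
  interpret prob_space "gaussian_matrix n p" by (rule prob_space_gaussian_matrix)
  let ?I = "{..<n} \<times> {..<p}"
  have nonempty: "?I \<noteq> {}" using assms by auto
  have sets: "sets (gaussian_matrix n p) = sets (PiM ?I (\<lambda>_. borel))"
    by (intro sets_PiM_cong) auto
  have rv: "random_variable borel (\<lambda>X. X ij)" if "ij \<in> ?I" for ij
    using measurable_component_singleton[OF that, of "\<lambda>_. normal_measure 1"] by simp
  have "distr (gaussian_matrix n p) (PiM ?I (\<lambda>_. borel)) (\<lambda>X. \<lambda>ij\<in>?I. X ij)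
      = distr (gaussian_matrix n p) (gaussian_matrix n p) (\<lambda>X. X)"
    by (intro distr_cong) (auto simp: sets space_PiM PiE_def extensional_restrict)
  also have "\<dots> = gaussian_matrix n p" by simp
  also have "\<dots> = PiM ?I (\<lambda>ij. distr (gaussian_matrix n p) borel (\<lambda>X. X ij))"
  proof (intro PiM_cong refl)
    fix ij assume ij: "ij \<in> ?I"
    have "distr (gaussian_matrix n p) borel (\<lambda>X. X ij)
        = distr (gaussian_matrix n p) (normal_measure 1) (\<lambda>X. X ij)"
      by (intro distr_cong) auto
    also have "\<dots> = normal_measure 1"
      using ij by (intro distr_PiM_component prob_space_normal_density) auto
    finally show "normal_measure 1 = distr (gaussian_matrix n p) borel (\<lambda>X. X ij)" ..
  qed
  finally show ?thesis
    using indep_vars_iff_distr_eq_PiM'[OF nonempty, where M' = "\<lambda>_. borel" and X = "\<lambda>ij X. X ij"] rv by simp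
qed

lemma gaussian_matrix_entry:
  assumes "i < n" "j < p"
  shows "distributed (gaussian_matrix n p) lborel (\<lambda>X. X (i, j)) (normal_density 0 1)"
proof -
  have ij: "(i, j) \<in> {..<n} \<times> {..<p}" using assms by simp
  have "distr (gaussian_matrix n p) lborel (\<lambda>X. X (i, j))
          = distr (gaussian_matrix n p) (normal_measure 1) (\<lambda>X. X (i, j))"
    by (intro distr_cong) auto
  also have "\<dots> = normal_measure 1"
    using ij by (intro distr_PiM_component prob_space_normal_density) auto
  finally show ?thesis
    using measurable_component_singleton[OF ij, of "\<lambda>_. normal_measure 1"]
    by (auto simp: distributed_def)
qed

text \<open>Each entry of \<open>Xz\<close> is a sum of independent normal variables. Coordinates with \<open>z\<^sub>j = 0\<close> are left out
  of the sum because their terms have no density.\<close>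

lemma gaussian_matrix_row:
  assumes i: "i < n" and z: "ip p z z > 0"
  shows "distributed (gaussian_matrix n p) lborel (\<lambda>X. mat_vec p X z i) (normal_density 0 (sqrt (ip p z z)))"
proof -
  interpret prob_space "gaussian_matrix n p" by (rule prob_space_gaussian_matrix)
  let ?J = "vec_support p z"
  have J: "?J \<noteq> {}"
  proof
    assume "?J = {}"
    then have "ip p z z = 0" unfolding ip_def by (intro sum.neutral) (auto simp: vec_support_def)
    then show False using z by simp
  qed
  let ?K = "\<lambda>j. {(i, j)}"
  have np: "n > 0" "p > 0" using i J by (auto simp: vec_support_def)
  have "indep_vars (\<lambda>j. PiM (?K j) (\<lambda>_. borel)) (\<lambda>j X. restrict (\<lambda>ij. X ij) (?K j)) ?J"
    using i by (intro indep_vars_restrict[OF indep_vars_gaussian_matrix[OF np]])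
      (auto simp: disjoint_family_on_def vec_support_def)
  then have "indep_vars (\<lambda>_. borel) (\<lambda>j X. restrict (\<lambda>ij. X ij) (?K j) (i, j) * z j) ?J"
    by (rule indep_vars_compose2[where Y = "\<lambda>j X. X (i, j) * z j" and N = "\<lambda>_. borel"]) measurable
  then have ind: "indep_vars (\<lambda>_. borel) (\<lambda>j X. X (i, j) * z j) ?J" by simp
  have "distributed (gaussian_matrix n p) lborel (\<lambda>X. X (i, j) * z j) (normal_density 0 \<bar>z j\<bar>)"
    if "j \<in> ?J" for j
    using normal_density_affine[OF gaussian_matrix_entry[of i n j p], of "z j" 0] that i
    by (simp add: vec_support_def mult.commute)
  from sum_indep_normal[OF _ J ind _ this]
  have "distributed (gaussian_matrix n p) lborel (\<lambda>X. \<Sum>j\<in>?J. X (i, j) * z j)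
      (normal_density 0 (sqrt (\<Sum>j\<in>?J. (z j)\<^sup>2)))"
    by (simp add: vec_support_def)
  moreover have "(\<Sum>j\<in>?J. X (i, j) * z j) = mat_vec p X z i" for X
    unfolding mat_vec_def by (intro sum.mono_neutral_left) (auto simp: vec_support_def)
  moreover have "(\<Sum>j\<in>?J. (z j)\<^sup>2) = ip p z z"
    unfolding ip_self_eq_power2 by (intro sum.mono_neutral_left) (auto simp: vec_support_def)
  ultimately show ?thesis by simp
qed

lemma borel_measurable_mat_vec [measurable]:
  "i < n \<Longrightarrow> (\<lambda>X. mat_vec p X z i) \<in> borel_measurable (gaussian_matrix n p)"
  unfolding mat_vec_def by measurable

lemma borel_measurable_ip_mat_vec [measurable]:
  "(\<lambda>X. ip n (mat_vec p X z) (mat_vec p X z)) \<in> borel_measurable (gaussian_matrix n p)"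
  unfolding ip_def by measurable

text \<open>The entries of \<open>Xz\<close> depend on disjoint rows, so they are independent and the transform of the
  \<open>\<chi>\<^sup>2\<close>-variable \<open>\<parallel>Xz\<parallel>\<^sup>2\<close> is a product.\<close>

lemma nn_integral_exp_gaussian_image:
  assumes "n > 0" and z: "ip p z z > 0" and l: "2 * l * ip p z z < 1"
  shows "(\<integral>\<^sup>+X. ennreal (exp (l * ip n (mat_vec p X z) (mat_vec p X z))) \<partial>gaussian_matrix n p)
    = ennreal (1 / sqrt (1 - 2 * l * ip p z z)) ^ n"
proof -
  interpret prob_space "gaussian_matrix n p" by (rule prob_space_gaussian_matrix)
  let ?K = "\<lambda>i. {i} \<times> {..<p}"
  let ?Y = "\<lambda>i X. ennreal (exp (l * (\<Sum>j<p. X (i, j) * z j)\<^sup>2))"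
  have "p > 0" using z by (cases p) (auto simp: ip_def)
  have "indep_vars (\<lambda>i. PiM (?K i) (\<lambda>_. borel)) (\<lambda>i X. restrict (\<lambda>ij. X ij) (?K i)) {..<n}"
    by (intro indep_vars_restrict[OF indep_vars_gaussian_matrix]) (use \<open>p > 0\<close> \<open>n > 0\<close> in \<open>auto simp: disjoint_family_on_def\<close>)
  then have "indep_vars (\<lambda>_. borel) (\<lambda>i X. ?Y i (restrict (\<lambda>ij. X ij) (?K i))) {..<n}"
    by (rule indep_vars_compose2[where Y = ?Y and N = "\<lambda>_. borel"]) measurable
  then have ind: "indep_vars (\<lambda>_. borel) (\<lambda>i X. ennreal (exp (l * (mat_vec p X z i)\<^sup>2))) {..<n}"
    by (simp add: mat_vec_def)
  have "(\<integral>\<^sup>+X. ennreal (exp (l * ip n (mat_vec p X z) (mat_vec p X z))) \<partial>gaussian_matrix n p)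
      = (\<integral>\<^sup>+X. (\<Prod>i<n. ennreal (exp (l * (mat_vec p X z i)\<^sup>2))) \<partial>gaussian_matrix n p)"
    by (simp add: ip_self_eq_power2 sum_distrib_left exp_sum prod_ennreal)
  also have "\<dots> = (\<Prod>i<n. \<integral>\<^sup>+X. ennreal (exp (l * (mat_vec p X z i)\<^sup>2)) \<partial>gaussian_matrix n p)"
    by (rule indep_vars_nn_integral[OF _ ind]) auto
  also have "\<dots> = (\<Prod>i<n. ennreal (1 / sqrt (1 - 2 * l * ip p z z)))"
  proof (intro prod.cong refl)
    fix i assume "i \<in> {..<n}"
    then have "(\<integral>\<^sup>+X. ennreal (exp (l * (mat_vec p X z i)\<^sup>2)) \<partial>gaussian_matrix n p)
        = (\<integral>\<^sup>+x. ennreal (normal_density 0 (sqrt (ip p z z)) x) * ennreal (exp (l * x\<^sup>2)) \<partial>lborel)"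
      using distributed_nn_integral[OF gaussian_matrix_row[OF _ z], of i n "\<lambda>x. ennreal (exp (l * x\<^sup>2))"]
      by simp
    also have "\<dots> = ennreal (1 / sqrt (1 - 2 * l * ip p z z))"
      using nn_integral_normal_exp_square[of "sqrt (ip p z z)" l] z l by (simp add: mult.commute)
    finally show "(\<integral>\<^sup>+X. ennreal (exp (l * (mat_vec p X z i)\<^sup>2)) \<partial>gaussian_matrix n p) = \<dots>" .
  qed
  also have "\<dots> = ennreal (1 / sqrt (1 - 2 * l * ip p z z)) ^ n" by simp
  finally show ?thesis .
qed

lemma inverse_sqrt_power_eq_exp:
  assumes "x > 0"
  shows "ennreal (1 / sqrt x) ^ n = ennreal (exp (- (real n / 2 * ln x)))"
proof -
  have "exp (ln (sqrt x)) = sqrt x"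
    by (rule exp_ln) (use assms in simp)
  then have "1 / sqrt x = exp (- (ln x / 2))"
    using assms by (simp only: exp_minus ln_sqrt less_imp_le inverse_eq_divide)
  then have "(1 / sqrt x) ^ n = exp (real n * - (ln x / 2))"
    by (simp only: exp_of_nat_mult)
  then show ?thesis
    using assms by (simp add: ennreal_power)
qed

text \<open>Chernoff bounds for a \<open>\<chi>\<^sup>2\<close>-variable. With tilt \<open>l = 1 / (160 \<parallel>z\<parallel>\<^sup>2)\<close> the exponent is
  \<open>n/2\<close> times a quantity that is linear in the deviation \<open>1/20\<close> up to the quadratic error in
  \<open>ln (1 \<plusminus> 1/80)\<close>, and this error is at most half of the linear gain.\<close>

lemma gaussian_image_norm_concentration:
  fixes n p :: nat
  defines "M \<equiv> gaussian_matrix n p"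
  assumes "n > 0" and z: "ip p z z > 0"
  shows "emeasure M {X \<in> space M. 21/20 * real n * ip p z z \<le> ip n (mat_vec p X z) (mat_vec p X z)}
           \<le> ennreal (exp (- (real n / 6400)))"
    and "emeasure M {X \<in> space M. ip n (mat_vec p X z) (mat_vec p X z) \<le> 19/20 * real n * ip p z z}
           \<le> ennreal (exp (- (real n / 6400)))"
proof -
  let ?f = "\<lambda>X. ip n (mat_vec p X z) (mat_vec p X z)"
  define l where "l = 1 / (160 * ip p z z)"
  have l: "l > 0" "l * ip p z z = 1/160" using z by (auto simp: l_def)
  have [measurable]: "?f \<in> borel_measurable M" unfolding M_def by measurable
  have mgf: "(\<integral>\<^sup>+X. ennreal (exp (c * ?f X)) * indicator (space M) X \<partial>M)
      = ennreal (exp (- (real n / 2 * ln (1 - 2 * (c * ip p z z)))))" if "2 * (c * ip p z z) < 1" for c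
  proof -
    have "(\<integral>\<^sup>+X. ennreal (exp (c * ?f X)) * indicator (space M) X \<partial>M) = (\<integral>\<^sup>+X. ennreal (exp (c * ?f X)) \<partial>M)"
      by (intro nn_integral_cong) auto
    then show ?thesis
      using that nn_integral_exp_gaussian_image[OF \<open>n > 0\<close> z, of c] unfolding M_def
      by (simp add: inverse_sqrt_power_eq_exp mult.assoc)
  qed
  have "emeasure M {X \<in> space M. 21/20 * real n * ip p z z \<le> ?f X}
      \<le> ennreal (exp (- l * (21/20 * real n * ip p z z))) *
         (\<integral>\<^sup>+X. ennreal (exp (l * ?f X)) * indicator (space M) X \<partial>M)"
    by (rule Chernoff_ineq_nn_integral_ge) (use l in auto)
  also have "\<dots> = ennreal (exp (- (21/20 * real n) * (l * ip p z z) - real n / 2 * ln (1 - 2 * (l * ip p z z))))"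
    by (subst mgf) (auto simp: l ennreal_mult[symmetric] mult_exp_exp algebra_simps)
  also have "\<dots> \<le> ennreal (exp (- (real n / 6400)))"
  proof (intro ennreal_leI, simp only: exp_le_cancel_iff l)
    have "- (1/80) - 2 * (1/80)\<^sup>2 \<le> ln (1 - 1/80::real)"
      by (rule ln_one_minus_pos_lower_bound) auto
    then have "real n / 2 * (- (1/80) - 2 * (1/80)\<^sup>2) \<le> real n / 2 * ln (1 - 1/80)"
      by (intro mult_left_mono) auto
    then show "- (21/20 * real n) * (1/160) - real n / 2 * ln (1 - 2 * (1/160)) \<le> - (real n / 6400)"
      by (simp add: power2_eq_square)
  qed
  finally show "emeasure M {X \<in> space M. 21/20 * real n * ip p z z \<le> ?f X} \<le> ennreal (exp (- (real n / 6400)))" .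
  have "emeasure M {X \<in> space M. ?f X \<le> 19/20 * real n * ip p z z}
      \<le> ennreal (exp (l * (19/20 * real n * ip p z z))) *
         (\<integral>\<^sup>+X. ennreal (exp (- l * ?f X)) * indicator (space M) X \<partial>M)"
    by (rule Chernoff_ineq_nn_integral_le) (use l in auto)
  also have "\<dots> = ennreal (exp ((19/20 * real n) * (l * ip p z z) - real n / 2 * ln (1 + 2 * (l * ip p z z))))"
    by (subst mgf) (auto simp: l ennreal_mult[symmetric] mult_exp_exp algebra_simps)
  also have "\<dots> \<le> ennreal (exp (- (real n / 6400)))"
  proof (intro ennreal_leI, simp only: exp_le_cancel_iff l)
    have "1/80 - (1/80)\<^sup>2 \<le> ln (1 + 1/80::real)"
      by (rule ln_one_plus_pos_lower_bound) auto
    then have "real n / 2 * (1/80 - (1/80)\<^sup>2) \<le> real n / 2 * ln (1 + 1/80)"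
      by (intro mult_left_mono) auto
    then show "19/20 * real n * (1/160) - real n / 2 * ln (1 + 2 * (1/160)) \<le> - (real n / 6400)"
      by (simp add: power2_eq_square)
  qed
  finally show "emeasure M {X \<in> space M. ?f X \<le> 19/20 * real n * ip p z z} \<le> ennreal (exp (- (real n / 6400)))" .
qed

section \<open>Gaussian matrices have the restricted isometry property\<close>

text \<open>The net for the union bound: integer vectors with entries at most \<open>p\<^sup>2\<close> on a set of \<open>s\<close>
  coordinates. Rounding a unit vector scaled by \<open>p\<^sup>2\<close> to it is so accurate that even the crude
  Frobenius bound controls the error. The logarithm of its size is
  \<open>O(s ln p)\<close>, of the order that the number of supports has anyway. The supports have exactly
  \<open>s\<close> elements to make counting easy.\<close>

definition grid :: "nat \<Rightarrow> nat \<Rightarrow> (nat set \<times> (nat \<Rightarrow> int)) set" where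
  "grid p s = (SIGMA T:{T. T \<subseteq> {..<p} \<and> card T = s}. PiE_dflt T 0 (\<lambda>_. {- (int p)\<^sup>2..(int p)\<^sup>2}))"

lemma finite_grid: "finite (grid p s)"
  unfolding grid_def
  by (intro finite_SigmaI finite_PiE_dflt) (auto intro: finite_subset[of _ "{..<p}"])

lemma card_grid_le:
  assumes "s \<le> p" "p \<ge> 3"
  shows "card (grid p s) \<le> p ^ (4 * s)"
proof -
  let ?F = "{T. T \<subseteq> {..<p} \<and> card T = s}"
  have card_dflt: "card (PiE_dflt T 0 (\<lambda>_. {- (int p)\<^sup>2..(int p)\<^sup>2})) = (2 * p\<^sup>2 + 1) ^ s"
    if "T \<in> ?F" for T
  proof -
    have "finite T" using that by (auto intro: finite_subset[of _ "{..<p}"])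
    moreover have "nat (1 + 2 * (int p)\<^sup>2) = 2 * p\<^sup>2 + 1"
      by (simp add: nat_eq_iff)
    ultimately show ?thesis
      using that by (subst card_PiE_dflt) (auto simp: algebra_simps)
  qed
  have "card (grid p s) = (\<Sum>T\<in>?F. (2 * p\<^sup>2 + 1) ^ s)"
    unfolding grid_def
    by (subst card_SigmaI) (auto simp: card_dflt intro!: finite_PiE_dflt intro: finite_subset[of _ "{..<p}"])
  also have "\<dots> = (p choose s) * (2 * p\<^sup>2 + 1) ^ s"
    by (simp add: n_subsets)
  also have "\<dots> \<le> p ^ s * (p ^ 3) ^ s"
  proof (intro mult_mono power_mono)
    show "p choose s \<le> p ^ s" by (rule binomial_le_pow) fact
    have "1 \<le> p\<^sup>2" using assms by simp
    then have "2 * p\<^sup>2 + 1 \<le> 3 * p\<^sup>2" by simp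
    also have "\<dots> \<le> p * p\<^sup>2" using assms by (intro mult_right_mono) auto
    also have "\<dots> = p ^ 3" by (simp add: power2_eq_square power3_eq_cube)
    finally show "2 * p\<^sup>2 + 1 \<le> p ^ 3" .
  qed auto
  also have "\<dots> = p ^ (4 * s)" by (simp add: power_mult[symmetric] power_add[symmetric])
  finally show ?thesis .
qed

definition near_isometric_at :: "nat \<Rightarrow> nat \<Rightarrow> (nat \<times> nat \<Rightarrow> real) \<Rightarrow> (nat \<Rightarrow> real) \<Rightarrow> bool" where
  "near_isometric_at n p X u \<longleftrightarrow>
     19/20 * real n * ip p u u \<le> ip n (mat_vec p X u) (mat_vec p X u) \<and>
     ip n (mat_vec p X u) (mat_vec p X u) \<le> 21/20 * real n * ip p u u"

lemma sqrt_ip_triangle: "sqrt (ip n (\<lambda>i. x i + y i) (\<lambda>i. x i + y i)) \<le> sqrt (ip n x x) + sqrt (ip n y y)"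
  using L2_set_triangle_ineq[of x y "{..<n}"] by (simp add: L2_set_def ip_self_eq_power2)

lemma sqrt_ip_triangle_diff: "sqrt (ip n x x) - sqrt (ip n y y) \<le> sqrt (ip n (\<lambda>i. x i + y i) (\<lambda>i. x i + y i))"
  using sqrt_ip_triangle[of n "\<lambda>i. x i + y i" "\<lambda>i. - y i"] by (simp add: ip_def)

lemma sqrt_ip_scale:
  assumes "c \<ge> 0"
  shows "sqrt (ip n (\<lambda>i. c * x i) (\<lambda>i. c * x i)) = c * sqrt (ip n x x)"
proof -
  have "ip n (\<lambda>i. c * x i) (\<lambda>i. c * x i) = c\<^sup>2 * ip n x x"
    by (simp add: ip_linear power2_eq_square)
  then show ?thesis using assms by (simp add: real_sqrt_mult)
qed

text \<open>A crude bound on the operator norm by the Frobenius norm (Cauchy--Schwarz in each row).\<close>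

lemma ip_mat_vec_le_columns:
  "ip n (mat_vec p X u) (mat_vec p X u) \<le> (\<Sum>j<p. ip n (col X j) (col X j)) * ip p u u"
proof -
  have "ip n (mat_vec p X u) (mat_vec p X u) \<le> (\<Sum>i<n. (\<Sum>j<p. (X (i, j))\<^sup>2) * ip p u u)"
    unfolding ip_self_eq_power2 mat_vec_def
    by (intro sum_mono Cauchy_Schwarz_ineq_sum)
  also have "\<dots> = (\<Sum>j<p. ip n (col X j) (col X j)) * ip p u u"
    unfolding ip_self_eq_power2 col_def
    by (simp add: sum_distrib_right[symmetric]) (rule disjI2, rule sum.swap)
  finally show ?thesis .
qed

text \<open>By homogeneity consider a unit vector \<open>v\<close> and round \<open>p\<^sup>2 v = x + e\<close> with \<open>x\<close> on the grid and
  \<open>\<bar>e\<^sub>j\<bar> \<le> 1\<close>. Then \<open>\<parallel>e\<parallel> \<le> p\<close>, and \<open>\<parallel>Xe\<parallel>\<close> is at most about \<open>p sqrt n\<close> because the columns are images of unit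
  vectors of the grid. Both errors are a fraction \<open>1 / p\<close> of the main terms \<open>p\<^sup>2\<close> and \<open>p\<^sup>2 sqrt n\<close>; for
  \<open>p \<ge> 200\<close> they fit between the constants \<open>1/20\<close> and \<open>1/10\<close>.\<close>

lemma near_isometric_on_grid_imp_RIP:
  assumes n: "n > 0" and p: "p \<ge> 200" and s: "1 \<le> s" "s \<le> p"
    and grid: "\<And>T z. (T, z) \<in> grid p s \<Longrightarrow> near_isometric_at n p X (\<lambda>j. real_of_int (z j))"
  shows "RIP n p s (1/10) X"
  unfolding RIP_def
proof (intro allI impI)
  fix u assume u: "sparse p s u"
  let ?X = "mat_vec p X"
  obtain T where T: "vec_support p u \<subseteq> T" "T \<subseteq> {..<p}" "card T = s"
    using exists_subset_between[of "vec_support p u" s "{..<p}"] u s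
    by (auto simp: sparse_def vec_support_def)
  show "(1 - 1/10) * real n * ip p u u \<le> ip n (?X u) (?X u) \<and>
        ip n (?X u) (?X u) \<le> (1 + 1/10) * real n * ip p u u"
  proof (cases "ip p u u = 0")
    case True
    then have "?X u = (\<lambda>i. 0)" by (rule mat_vec_null)
    then show ?thesis using True by (simp add: ip_def)
  next
    case False
    define c where "c = sqrt (ip p u u)"
    have c: "c > 0" "c\<^sup>2 = ip p u u"
      using False ip_self_nonneg[of p u] by (auto simp: c_def)
    define v where "v = (\<lambda>j. (1 / c) * u j)"
    have vv: "ip p v v = 1"
    proof -
      have "ip p v v = (1 / c) * ((1 / c) * c\<^sup>2)" unfolding v_def c(2) by (simp only: ip_linear)
      then show ?thesis using c(1) by (simp add: power2_eq_square)
    qed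
    have v_le: "\<bar>v j\<bar> \<le> 1" if "j < p" for j
    proof -
      have "(v j)\<^sup>2 \<le> ip p v v"
        unfolding ip_self_eq_power2 using that by (intro member_le_sum) auto
      then show ?thesis using vv by (simp add: abs_square_le_1)
    qed
    define z where "z = (\<lambda>j. if j \<in> T then \<lfloor>(real p)\<^sup>2 * v j\<rfloor> else 0)"
    define x where "x = (\<lambda>j. real_of_int (z j))"
    define e where "e = (\<lambda>j. (real p)\<^sup>2 * v j - x j)"
    have "(T, z) \<in> grid p s"
    proof -
      have "\<lfloor>(real p)\<^sup>2 * v j\<rfloor> \<in> {- (int p)\<^sup>2..(int p)\<^sup>2}" if "j \<in> T" for j
      proof -
        have "\<bar>v j\<bar> \<le> 1" using v_le that T by auto
        then have 1: "(real p)\<^sup>2 * v j \<le> (real p)\<^sup>2 * 1" "(real p)\<^sup>2 * (-1) \<le> (real p)\<^sup>2 * v j"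
          by (intro mult_left_mono; simp add: abs_le_iff)+
        then have "- (int p)\<^sup>2 \<le> \<lfloor>(real p)\<^sup>2 * v j\<rfloor>"
          and "real_of_int \<lfloor>(real p)\<^sup>2 * v j\<rfloor> \<le> real_of_int ((int p)\<^sup>2)"
          by (simp add: le_floor_iff) (use 1 in \<open>auto intro: order_trans[OF of_int_floor_le]\<close>)
        then show ?thesis by (simp only: of_int_le_iff atLeastAtMost_iff)
      qed
      then show ?thesis using T unfolding grid_def PiE_dflt_def z_def by simp
    qed
    then have iso: "near_isometric_at n p X x" using grid by (simp add: x_def)
    have e_le: "\<bar>e j\<bar> \<le> 1" if "j < p" for j
    proof (cases "j \<in> T")
      case True
      then show ?thesis by (simp add: e_def x_def z_def abs_le_iff) linarith
    next
      case False
      then have "u j = 0" using T that by (auto simp: vec_support_def)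
      then show ?thesis using False by (simp add: e_def x_def z_def v_def)
    qed
    have ee: "ip p e e \<le> real p"
    proof -
      have "ip p e e \<le> (\<Sum>j<p. 1)"
        unfolding ip_self_eq_power2 using e_le by (intro sum_mono) (simp add: abs_square_le_1)
      then show ?thesis by simp
    qed
    have columns: "ip n (col X j) (col X j) \<le> 21/20 * real n" if j: "j < p" for j
    proof -
      obtain T' where T': "{j} \<subseteq> T'" "T' \<subseteq> {..<p}" "card T' = s"
        using exists_subset_between[of "{j}" s "{..<p}"] j s by auto
      have "(T', \<lambda>l. if l = j then 1 else 0) \<in> grid p s"
        using T' p order_trans[of "-1" 0 "(int p)\<^sup>2"] by (auto simp: grid_def PiE_dflt_def)
      from grid[OF this] have "near_isometric_at n p X (\<lambda>l. if l = j then 1 else 0)"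
        by (simp add: if_distrib[of real_of_int] cong: if_cong)
      then show ?thesis
        using that by (simp add: near_isometric_at_def mat_vec_unit ip_unit)
    qed
    define a where "a = sqrt (21/20 * real n)"
    define b where "b = sqrt (19/20 * real n)"
    have a: "a \<ge> 0" and b: "b \<ge> 0" and a2: "a\<^sup>2 = 21/20 * real n" and b2: "b\<^sup>2 = 19/20 * real n"
      by (auto simp: a_def b_def)
    have ab: "a \<le> 2 * b"
    proof -
      have "2 * b = sqrt (2\<^sup>2 * (19/20 * real n))" unfolding b_def by (simp only: real_sqrt_mult real_sqrt_abs)
      then show ?thesis unfolding a_def by simp
    qed
    have Xe: "sqrt (ip n (?X e) (?X e)) \<le> a * real p"
    proof -
      have "ip n (?X e) (?X e) \<le> (\<Sum>j<p. ip n (col X j) (col X j)) * ip p e e"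
        by (rule ip_mat_vec_le_columns)
      also have "\<dots> \<le> (\<Sum>j<p. 21/20 * real n) * real p"
        using columns ee by (intro mult_mono sum_mono sum_nonneg) (auto simp: ip_self_nonneg)
      also have "\<dots> = (a * real p)\<^sup>2" unfolding power_mult_distrib a2 by (simp add: power2_eq_square)
      finally show ?thesis using a by (intro real_le_lsqrt) auto
    qed
    have sqe: "sqrt (ip p e e) \<le> real p"
    proof -
      have "real p \<le> (real p)\<^sup>2" using p by (simp add: power2_eq_square)
      with ee have "ip p e e \<le> (real p)\<^sup>2" by (rule order_trans)
      then show ?thesis by (intro real_le_lsqrt) auto
    qed
    have pv: "(\<lambda>j. x j + e j) = (\<lambda>j. (real p)\<^sup>2 * v j)" by (simp add: e_def)
    have npv: "sqrt (ip p (\<lambda>j. x j + e j) (\<lambda>j. x j + e j)) = (real p)\<^sup>2"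
      unfolding pv by (simp add: sqrt_ip_scale vv)
    have nx: "sqrt (ip p x x) \<le> (real p)\<^sup>2 + real p" "(real p)\<^sup>2 - real p \<le> sqrt (ip p x x)"
      using sqrt_ip_triangle[of p x e] sqrt_ip_triangle_diff[of p x e] npv sqe by linarith+
    have Xx: "b * sqrt (ip p x x) \<le> sqrt (ip n (?X x) (?X x))" "sqrt (ip n (?X x) (?X x)) \<le> a * sqrt (ip p x x)"
      using iso unfolding near_isometric_at_def a_def b_def real_sqrt_mult[symmetric] by auto
    have nXpv: "sqrt (ip n (\<lambda>i. ?X x i + ?X e i) (\<lambda>i. ?X x i + ?X e i)) = (real p)\<^sup>2 * sqrt (ip n (?X v) (?X v))"
      unfolding mat_vec_add[symmetric] pv mat_vec_scale
      by (simp add: sqrt_ip_scale)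
    have up: "(real p)\<^sup>2 * sqrt (ip n (?X v) (?X v)) \<le> a * ((real p)\<^sup>2 + 2 * real p)"
      using sqrt_ip_triangle[of n "?X x" "?X e"] Xx(2) Xe mult_left_mono[OF nx(1) a]
      unfolding nXpv by (simp add: algebra_simps)
    have lo: "b * ((real p)\<^sup>2 - 3 * real p) \<le> (real p)\<^sup>2 * sqrt (ip n (?X v) (?X v))"
      using sqrt_ip_triangle_diff[of n "?X x" "?X e"] Xx(1) Xe mult_left_mono[OF nx(2) b]
        mult_right_mono[OF ab, of "real p"]
      unfolding nXpv by (simp add: algebra_simps)
    have p_ge: "200 * real p \<le> (real p)\<^sup>2"
      using p by (simp add: power2_eq_square)
    have p2: "(real p)\<^sup>2 > 0" using p by simp
    have "(real p)\<^sup>2 * sqrt (ip n (?X v) (?X v)) \<le> (real p)\<^sup>2 * (a * (101/100))"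
      using up mult_left_mono[OF p_ge a] by (simp add: algebra_simps)
    then have up': "sqrt (ip n (?X v) (?X v)) \<le> a * (101/100)" using p2 by simp
    have "(real p)\<^sup>2 * (b * (197/200)) \<le> (real p)\<^sup>2 * sqrt (ip n (?X v) (?X v))"
      using lo mult_left_mono[OF p_ge b] by (simp add: algebra_simps)
    then have lo': "b * (197/200) \<le> sqrt (ip n (?X v) (?X v))" using p2 by simp
    have "ip n (?X v) (?X v) \<le> (a * (101/100))\<^sup>2"
      using power_mono[OF up', of 2] ip_self_nonneg[of n "?X v"] by simp
    also have "\<dots> \<le> 11/10 * real n" unfolding power_mult_distrib a2 by (simp add: power_divide)
    finally have U: "ip n (?X v) (?X v) \<le> 11/10 * real n" .
    have "9/10 * real n \<le> (b * (197/200))\<^sup>2" unfolding power_mult_distrib b2 by (simp add: power_divide)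
    also have "\<dots> \<le> ip n (?X v) (?X v)"
      using power_mono[OF lo', of 2] b ip_self_nonneg[of n "?X v"] by simp
    finally have L: "9/10 * real n \<le> ip n (?X v) (?X v)" .
    have "u = (\<lambda>j. c * v j)" using c by (simp add: v_def)
    then have "ip n (?X u) (?X u) = c\<^sup>2 * ip n (?X v) (?X v)"
      by (simp add: mat_vec_scale ip_linear power2_eq_square)
    then show ?thesis
      using mult_left_mono[OF U, of "c\<^sup>2"] mult_left_mono[OF L, of "c\<^sup>2"] c(2) ip_self_nonneg[of p u]
      by (simp add: algebra_simps)
  qed
qed

text \<open>Union bound over the grid. The exceptional set \<open>G\<close> is named explicitly because the property itself
  quantifies over uncountably many vectors.\<close>

lemma gaussian_matrix_RIP:
  assumes n: "n > 0" and p: "p \<ge> 200" and s: "1 \<le> s" "s \<le> p"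
  obtains G where "G \<in> sets (gaussian_matrix n p)"
    "emeasure (gaussian_matrix n p) G \<le> ennreal (2 * real p ^ (4 * s) * exp (- (real n / 6400)))"
    "\<And>X. X \<in> space (gaussian_matrix n p) - G \<Longrightarrow> RIP n p s (1/10) X"
proof -
  let ?M = "gaussian_matrix n p"
  define E where "E = (\<lambda>Tz :: nat set \<times> (nat \<Rightarrow> int). {X \<in> space ?M. \<not> near_isometric_at n p X (\<lambda>j. real_of_int (snd Tz j))})"
  define G where "G = (\<Union>Tz\<in>grid p s. E Tz)"
  have Em: "E Tz \<in> sets ?M" for Tz
    unfolding E_def near_isometric_at_def by measurable
  have Ele: "emeasure ?M (E Tz) \<le> ennreal (2 * exp (- (real n / 6400)))" for Tz
  proof -
    define x where "x = (\<lambda>j. real_of_int (snd Tz j))"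
    let ?f = "\<lambda>X. ip n (mat_vec p X x) (mat_vec p X x)"
    show ?thesis
    proof (cases "ip p x x = 0")
      case True
      then have "mat_vec p X x = (\<lambda>i. 0)" for X by (rule mat_vec_null)
      then have "near_isometric_at n p X x" for X
        using True by (simp add: near_isometric_at_def) (simp add: ip_def)
      then have "E Tz = {}" by (simp add: E_def x_def)
      then show ?thesis by simp
    next
      case False
      then have pos: "ip p x x > 0" using ip_self_nonneg[of p x] by simp
      let ?U = "{X \<in> space ?M. 21/20 * real n * ip p x x \<le> ?f X}"
      let ?L = "{X \<in> space ?M. ?f X \<le> 19/20 * real n * ip p x x}"
      have "E Tz \<subseteq> ?U \<union> ?L"
        by (auto simp: E_def near_isometric_at_def x_def)
      then have "emeasure ?M (E Tz) \<le> emeasure ?M (?U \<union> ?L)"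
        by (intro emeasure_mono) measurable
      also have "\<dots> \<le> emeasure ?M ?U + emeasure ?M ?L"
        by (intro emeasure_subadditive) measurable
      also have "\<dots> \<le> ennreal (exp (- (real n / 6400))) + ennreal (exp (- (real n / 6400)))"
        by (intro add_mono gaussian_image_norm_concentration n pos)
      also have "\<dots> = ennreal (2 * exp (- (real n / 6400)))"
        by (subst ennreal_plus[symmetric]) auto
      finally show ?thesis .
    qed
  qed
  show ?thesis
  proof (rule that)
    show "G \<in> sets ?M" unfolding G_def using finite_grid Em by (intro sets.finite_UN) auto
    have "emeasure ?M G \<le> (\<Sum>Tz\<in>grid p s. emeasure ?M (E Tz))"
      unfolding G_def using Em by (intro emeasure_subadditive_finite finite_grid) auto
    also have "\<dots> \<le> (\<Sum>Tz\<in>grid p s. ennreal (2 * exp (- (real n / 6400))))"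
      by (intro sum_mono Ele)
    also have "\<dots> = ennreal (real (card (grid p s)) * (2 * exp (- (real n / 6400))))"
      by (simp add: ennreal_mult ennreal_of_nat_eq_real_of_nat)
    also have "\<dots> \<le> ennreal (real (p ^ (4 * s)) * (2 * exp (- (real n / 6400))))"
      using card_grid_le[OF s(2)] p by (intro ennreal_leI mult_right_mono) (auto simp del: of_nat_power)
    finally show "emeasure ?M G \<le> ennreal (2 * real p ^ (4 * s) * exp (- (real n / 6400)))"
      by (simp add: ac_simps)
    show "RIP n p s (1/10) X" if "X \<in> space ?M - G" for X
    proof (rule near_isometric_on_grid_imp_RIP[OF n p s])
      fix T z assume "(T, z) \<in> grid p s"
      with that show "near_isometric_at n p X (\<lambda>j. real_of_int (z j))"
        unfolding G_def E_def by force
    qed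
  qed
qed

section \<open>Measurability of the existence of a local minimum\<close>

text \<open>Both quantifiers may range over uncountable sets, so measurability needs an argument. By continuity the
  universal one may be restricted to a countable dense set. For the existential one, compactness
  turns exact minimizers into approximate ones for every tolerance \<open>1 / (l + 1)\<close>, and these can
  be found in a countable dense set.\<close>

lemma sets_Collect_exists_compact_minimizer:
  fixes f :: "'a \<Rightarrow> 'b :: {metric_space, second_countable_topology} \<Rightarrow> real"
  assumes K: "compact K" and cont: "\<And>x. continuous_on UNIV (f x)"
    and meas [measurable]: "\<And>\<beta>. (\<lambda>x. f x \<beta>) \<in> borel_measurable M"
  shows "{x \<in> space M. \<exists>\<beta>\<in>K. \<forall>\<gamma>\<in>C. f x \<beta> \<le> f x \<gamma>} \<in> sets M"
proof -
  obtain D where D: "countable D" "D \<subseteq> C" "C \<subseteq> closure D" by (rule separable)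
  obtain E where E: "countable E" "E \<subseteq> K" "K \<subseteq> closure E" by (rule separable)
  have eq: "(\<exists>\<beta>\<in>K. \<forall>\<gamma>\<in>C. f x \<beta> \<le> f x \<gamma>) \<longleftrightarrow>
        (\<forall>l::nat. \<exists>\<beta>\<in>E. \<forall>\<gamma>\<in>D. f x \<beta> \<le> f x \<gamma> + 1 / Suc l)" for x
  proof
    assume "\<exists>\<beta>\<in>K. \<forall>\<gamma>\<in>C. f x \<beta> \<le> f x \<gamma>"
    then obtain \<beta> where \<beta>: "\<beta> \<in> K" "\<And>\<gamma>. \<gamma> \<in> C \<Longrightarrow> f x \<beta> \<le> f x \<gamma>" by blast
    show "\<forall>l::nat. \<exists>\<beta>\<in>E. \<forall>\<gamma>\<in>D. f x \<beta> \<le> f x \<gamma> + 1 / Suc l"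
    proof
      fix l :: nat
      let ?U = "{\<beta>'. f x \<beta>' < f x \<beta> + 1 / Suc l}"
      have "open ?U" using cont by (intro open_Collect_less) auto
      moreover have "\<beta> \<in> ?U" "\<beta> \<in> closure E" using \<beta> E by auto
      ultimately obtain \<beta>' where \<beta>': "\<beta>' \<in> E" "\<beta>' \<in> ?U"
        using open_Int_closure_eq_empty[of ?U E] by blast
      then have "\<forall>\<gamma>\<in>D. f x \<beta>' \<le> f x \<gamma> + 1 / Suc l"
        using \<beta>(2) D(2) by (force intro: less_imp_le elim: order_trans)
      then show "\<exists>\<beta>\<in>E. \<forall>\<gamma>\<in>D. f x \<beta> \<le> f x \<gamma> + 1 / Suc l" using \<beta>' by blast
    qed
  next
    assume *: "\<forall>l::nat. \<exists>\<beta>\<in>E. \<forall>\<gamma>\<in>D. f x \<beta> \<le> f x \<gamma> + 1 / Suc l"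
    then have "K \<noteq> {}" using E by blast
    then obtain \<beta> where \<beta>: "\<beta> \<in> K" "\<And>\<beta>'. \<beta>' \<in> K \<Longrightarrow> f x \<beta> \<le> f x \<beta>'"
      using continuous_attains_inf[OF K _ continuous_on_subset[OF cont subset_UNIV]] by blast
    have "f x \<beta> \<le> f x \<gamma>" if \<gamma>: "\<gamma> \<in> D" for \<gamma>
    proof (rule field_le_epsilon)
      fix e :: real assume "e > 0"
      then obtain l where l: "1 / real (Suc l) < e"
        using reals_Archimedean[of e] by (auto simp: inverse_eq_divide)
      obtain \<beta>' where "\<beta>' \<in> E" "f x \<beta>' \<le> f x \<gamma> + 1 / Suc l" using * \<gamma> by blast
      then show "f x \<beta> \<le> f x \<gamma> + e" using \<beta>(2)[of \<beta>'] E(2) l by force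
    qed
    then have "D \<subseteq> {\<gamma>. f x \<beta> \<le> f x \<gamma>}" by auto
    moreover have "closed {\<gamma>. f x \<beta> \<le> f x \<gamma>}" using cont by (intro closed_Collect_le) auto
    ultimately have "C \<subseteq> {\<gamma>. f x \<beta> \<le> f x \<gamma>}" using D(3) closure_minimal by blast
    then show "\<exists>\<beta>\<in>K. \<forall>\<gamma>\<in>C. f x \<beta> \<le> f x \<gamma>" using \<beta>(1) by blast
  qed
  have "Measurable.pred M (\<lambda>x. \<forall>l::nat. \<exists>\<beta>\<in>E. \<forall>\<gamma>\<in>D. f x \<beta> \<le> f x \<gamma> + 1 / Suc l)"
    using D(1) E(1) by measurable
  then show ?thesis unfolding eq by (simp add: pred_def)
qed

text \<open>The vectors with support exactly \<open>S\<close> form no compact set, but a countable union of these ones: the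
  entries on \<open>S\<close> are bounded and bounded away from zero. Coordinates outside \<open>S\<close> are zero everywhere,
  including those beyond the dimension.\<close>

definition annulus_box :: "nat set \<Rightarrow> real \<Rightarrow> (nat \<Rightarrow> real) set" where
  "annulus_box S m = {\<beta>. \<forall>j. \<beta> j \<in> (if j \<in> S then {- m..- (1 / m)} \<union> {1 / m..m} else {0})}"

lemma compact_annulus_box: "compact (annulus_box S m)"
proof -
  have "annulus_box S m = PiE UNIV (\<lambda>j. if j \<in> S then {- m..- (1 / m)} \<union> {1 / m..m} else {0})"
    by (auto simp: annulus_box_def PiE_def Pi_def)
  moreover have "compactin (product_topology (\<lambda>_. euclidean) UNIV) \<dots>"
    unfolding compactin_PiE by (intro disjI2 ballI) (auto simp: compactin_euclidean_iff intro!: compact_Un)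
  ultimately show ?thesis by (simp add: euclidean_product_topology compactin_euclidean_iff)
qed

lemma mem_annulus_boxI:
  assumes "finite S" "\<And>j. j \<in> S \<Longrightarrow> u j \<noteq> 0"
  obtains m :: nat where "restr S u \<in> annulus_box S (Suc m)"
proof -
  obtain m :: nat where m: "(\<Sum>j\<in>S. \<bar>u j\<bar> + 1 / \<bar>u j\<bar>) \<le> real m" using real_arch_simple by blast
  have "restr S u j \<in> (if j \<in> S then {- real (Suc m)..- (1 / real (Suc m))} \<union> {1 / real (Suc m)..real (Suc m)} else {0})" for j
  proof (cases "j \<in> S")
    case True
    have "\<bar>u j\<bar> + 1 / \<bar>u j\<bar> \<le> (\<Sum>j\<in>S. \<bar>u j\<bar> + 1 / \<bar>u j\<bar>)"
      using True assms by (intro member_le_sum) auto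
    then have 1: "\<bar>u j\<bar> + 1 / \<bar>u j\<bar> \<le> real (Suc m)" using m by simp
    have pos: "\<bar>u j\<bar> > 0" using assms True by simp
    then have le: "\<bar>u j\<bar> \<le> real (Suc m)" "1 / \<bar>u j\<bar> \<le> real (Suc m)" using 1 by (smt (verit) divide_pos_pos)+
    then have "1 / real (Suc m) \<le> \<bar>u j\<bar>" using pos by (simp add: field_simps)
    then show ?thesis using True le by (auto simp: restr_def abs_if split: if_splits)
  qed (simp add: restr_def)
  then show ?thesis using that unfolding annulus_box_def by blast
qed

lemma vec_support_annulus_box:
  assumes "S \<subseteq> {..<p}" "\<beta> \<in> annulus_box S m" "m > 0"
  shows "vec_support p \<beta> = S"
proof -
  have "\<beta> j \<noteq> 0 \<longleftrightarrow> j \<in> S" for j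
  proof -
    have "\<beta> j \<in> (if j \<in> S then {- m..- (1 / m)} \<union> {1 / m..m} else {0})"
      using assms(2) by (simp add: annulus_box_def)
    moreover have "1 / m > 0" using assms(3) by simp
    ultimately show ?thesis by (smt (verit) UnE atLeastAtMost_iff singletonD)
  qed
  then show ?thesis using assms(1) by (auto simp: vec_support_def)
qed

lemma residual_norm_restr:
  "residual_norm n p X Y (restr (vec_support p \<beta>) \<beta>) = residual_norm n p X Y \<beta>"
proof -
  have "mat_vec p X (restr (vec_support p \<beta>) \<beta>) = mat_vec p X \<beta>"
    by (auto simp: mat_vec_def restr_def vec_support_def intro!: sum.cong)
  then show ?thesis by (simp add: residual_norm_def)
qed

lemma continuous_on_residual_norm: "continuous_on UNIV (residual_norm n p X Y)"
  unfolding residual_norm_def L2_set_def mat_vec_def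
  by (intro continuous_intros continuous_on_product_coordinates)

text \<open>The set of competitors depends on the candidate only through its support. So the event is a countable
  union, over supports and boxes, of events that a minimizer exists in a compact set.\<close>

lemma sets_Collect_nontrivial_local_min:
  "{(X, W) \<in> space (gaussian_model n p \<sigma>). \<exists>\<beta>. nontrivial_local_min n p k X (response p X \<beta>s W) \<beta>s \<beta>}
     \<in> sets (gaussian_model n p \<sigma>)"
proof -
  let ?M = "gaussian_model n p \<sigma>"
  define f where "f = (\<lambda>x. residual_norm n p (fst x) (response p (fst x) \<beta>s (snd x)))"
  define C where "C = (\<lambda>S. {\<beta>. sparse p k \<beta> \<and>
        max (card (S - vec_support p \<beta>)) (card (vec_support p \<beta> - S)) \<le> 1})"
  define I where "I = {S. S \<subseteq> {..<p} \<and> card S \<le> k \<and> S \<noteq> vec_support p \<beta>s}"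
  have cont: "continuous_on UNIV (f x)" for x
    by (simp add: f_def continuous_on_residual_norm)
  have meas: "(\<lambda>x. f x \<beta>) \<in> borel_measurable ?M" for \<beta>
  proof -
    have X [measurable]: "(\<lambda>x. fst x (i, j)) \<in> borel_measurable ?M" if "i \<in> {..<n}" "j \<in> {..<p}" for i j
      unfolding gaussian_model_def using that
      by (intro measurable_compose[OF measurable_fst])
        (use measurable_component_singleton[of "(i, j)" "{..<n} \<times> {..<p}" "\<lambda>_. normal_measure 1"] in auto)
    have W [measurable]: "(\<lambda>x. snd x i) \<in> borel_measurable ?M" if "i \<in> {..<n}" for i
      unfolding gaussian_model_def using that
      by (intro measurable_compose[OF measurable_snd])
        (use measurable_component_singleton[of i "{..<n}" "\<lambda>_. normal_measure \<sigma>"] in auto)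
    show ?thesis
      unfolding f_def residual_norm_def L2_set_def response_def mat_vec_def
      by measurable
  qed
  have eq: "(\<exists>\<beta>. nontrivial_local_min n p k X (response p X \<beta>s W) \<beta>s \<beta>) \<longleftrightarrow>
      (\<exists>S\<in>I. \<exists>m::nat. \<exists>\<beta>\<in>annulus_box S (Suc m). \<forall>\<gamma>\<in>C S. f (X, W) \<beta> \<le> f (X, W) \<gamma>)" for X W
  proof
    assume "\<exists>\<beta>. nontrivial_local_min n p k X (response p X \<beta>s W) \<beta>s \<beta>"
    then obtain \<beta> where \<beta>: "nontrivial_local_min n p k X (response p X \<beta>s W) \<beta>s \<beta>" by blast
    let ?S = "vec_support p \<beta>"
    obtain m :: nat where m: "restr ?S \<beta> \<in> annulus_box ?S (Suc m)"
      by (rule mem_annulus_boxI[of ?S \<beta>]) (auto simp: vec_support_def)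
    moreover have "?S \<in> I"
      using \<beta> by (auto simp: I_def nontrivial_local_min_def sparse_def vec_support_def)
    moreover have "\<forall>\<gamma>\<in>C ?S. f (X, W) (restr ?S \<beta>) \<le> f (X, W) \<gamma>"
      using \<beta> by (auto simp: f_def C_def nontrivial_local_min_def residual_norm_restr)
    ultimately show "\<exists>S\<in>I. \<exists>m::nat. \<exists>\<beta>\<in>annulus_box S (Suc m). \<forall>\<gamma>\<in>C S. f (X, W) \<beta> \<le> f (X, W) \<gamma>"
      by blast
  next
    assume "\<exists>S\<in>I. \<exists>m::nat. \<exists>\<beta>\<in>annulus_box S (Suc m). \<forall>\<gamma>\<in>C S. f (X, W) \<beta> \<le> f (X, W) \<gamma>"
    then obtain S m \<beta> where *: "S \<in> I" "\<beta> \<in> annulus_box S (real (Suc m))"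
      "\<And>\<gamma>. \<gamma> \<in> C S \<Longrightarrow> f (X, W) \<beta> \<le> f (X, W) \<gamma>" by blast
    then have "vec_support p \<beta> = S"
      by (intro vec_support_annulus_box) (auto simp: I_def)
    then have "nontrivial_local_min n p k X (response p X \<beta>s W) \<beta>s \<beta>"
      using * by (auto simp: nontrivial_local_min_def I_def C_def f_def sparse_def)
    then show "\<exists>\<beta>. nontrivial_local_min n p k X (response p X \<beta>s W) \<beta>s \<beta>" by blast
  qed
  have "finite I" unfolding I_def by (rule finite_subset[of _ "Pow {..<p}"]) auto
  have "{(X, W) \<in> space ?M. \<exists>\<beta>. nontrivial_local_min n p k X (response p X \<beta>s W) \<beta>s \<beta>}
      = (\<Union>S\<in>I. \<Union>m::nat. {x \<in> space ?M. \<exists>\<beta>\<in>annulus_box S (Suc m). \<forall>\<gamma>\<in>C S. f x \<beta> \<le> f x \<gamma>})"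
    unfolding eq by auto
  also have "\<dots> \<in> sets ?M"
    using \<open>finite I\<close>
    by (intro sets.finite_UN sets.countable_UN image_subsetI sets_Collect_exists_compact_minimizer
        compact_annulus_box cont meas)
  finally show ?thesis .
qed

section \<open>The noise, conditionally on a restricted isometry\<close>

text \<open>The vector obtained is row \<open>i\<close> of the pseudo-inverse of \<open>X\<^sub>T\<close>. It is the part \<open>u\<close> of column \<open>i\<close>
  orthogonal to the other columns of \<open>T\<close>, divided by \<open>\<parallel>u\<parallel>\<^sup>2\<close>; and \<open>\<parallel>u\<parallel>\<^sup>2 \<ge> 9n/10\<close> since \<open>u\<close> is the image of a
  sparse vector with \<open>i\<close>-th entry \<open>1\<close>.\<close>

lemma RIP_dual_vector_exists:
  assumes rip: "RIP n p s (1/10) X" and n: "n > 0" and T: "T \<subseteq> {..<p}" "card T \<le> s" and i: "i \<in> T"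
  obtains d where
    "\<And>l. l \<in> T \<Longrightarrow> ip n (mat_vec p X (restr T d)) (col X l) = (if l = i then 1 else 0)"
    "ip n (mat_vec p X (restr T d)) (mat_vec p X (restr T d)) \<le> 10 / (9 * real n)"
proof -
  have fin: "finite T" using T finite_subset by blast
  have sub: "T - {i} \<subseteq> {..<p}" using T by auto
  obtain a where a: "\<And>l. l \<in> T - {i} \<Longrightarrow>
      ip n (\<lambda>m. col X i m - mat_vec p X (restr (T - {i}) a) m) (col X l) = 0"
    using column_projection_exists[OF sub] by blast
  define d where "d = (\<lambda>l. if l = i then 1 else - restr (T - {i}) a l)"
  define u where "u = mat_vec p X (restr T d)"
  have ip': "i < p" using i T by auto
  have "restr T d = (\<lambda>l. (if l = i then 1 else 0) - restr (T - {i}) a l)"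
    using i by (auto simp: restr_def d_def)
  then have u: "u = (\<lambda>m. col X i m - mat_vec p X (restr (T - {i}) a) m)"
    using mat_vec_diff[of p X "\<lambda>l. if l = i then 1 else 0" "restr (T - {i}) a"] ip'
    by (simp add: u_def mat_vec_unit)
  have orth: "ip n u (col X l) = 0" if "l \<in> T" "l \<noteq> i" for l
    using a[of l] that by (simp add: u)
  have ui: "ip n u (col X i) = ip n u u"
  proof -
    have "ip n u u = (\<Sum>l\<in>T. restr T d l * ip n (col X l) u)"
      by (subst (1) u_def) (subst ip_mat_vec_restr[OF T(1)], rule sum.cong, auto simp: restr_def)
    also have "\<dots> = (\<Sum>l\<in>T. if l = i then ip n u (col X i) else 0)"
      using orth i by (intro sum.cong) (auto simp: restr_def d_def ip_commute[of n _ u])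
    also have "\<dots> = ip n u (col X i)" using fin i by simp
    finally show ?thesis by simp
  qed
  have "1 \<le> ip p (restr T d) (restr T d)"
  proof -
    have "(restr T d i)\<^sup>2 \<le> ip p (restr T d) (restr T d)"
      unfolding ip_self_eq_power2 using ip' by (intro member_le_sum) auto
    then show ?thesis using i by (simp add: restr_def d_def)
  qed
  moreover have "sparse p s (restr T d)"
  proof -
    have "card (vec_support p (restr T d)) \<le> card T"
      using fin by (intro card_mono) (auto simp: vec_support_restr)
    then show ?thesis using T by (simp add: sparse_def)
  qed
  then have "(1 - 1/10) * real n * ip p (restr T d) (restr T d) \<le> ip n u u"
    unfolding u_def by (rule RIP_lower[OF rip])
  ultimately have uu: "9/10 * real n \<le> ip n u u"
    using mult_left_mono[of 1 "ip p (restr T d) (restr T d)" "9/10 * real n"] by simp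
  define q where "q = ip n u u"
  have q: "q > 0" "9/10 * real n \<le> q" using uu n by (auto simp: q_def)
  have v: "mat_vec p X (restr T (\<lambda>l. (1 / q) * d l)) = (\<lambda>m. (1 / q) * u m)"
  proof -
    have "restr T (\<lambda>l. (1 / q) * d l) = (\<lambda>l. (1 / q) * restr T d l)" by (auto simp: restr_def)
    then show ?thesis by (simp only: mat_vec_scale u_def)
  qed
  show ?thesis
  proof (rule that[of "\<lambda>l. (1 / q) * d l"])
    show "ip n (mat_vec p X (restr T (\<lambda>l. (1 / q) * d l))) (col X l) = (if l = i then 1 else 0)"
      if "l \<in> T" for l
      unfolding v ip_scale_left using orth[OF that] ui q by (auto simp: q_def)
    have "ip n (mat_vec p X (restr T (\<lambda>l. (1 / q) * d l))) (mat_vec p X (restr T (\<lambda>l. (1 / q) * d l))) = 1 / q"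
      unfolding v ip_scale_left ip_scale_right using q by (simp add: q_def)
    also have "\<dots> \<le> 10 / (9 * real n)"
      using q n by (simp add: field_simps)
    finally show "ip n (mat_vec p X (restr T (\<lambda>l. (1 / q) * d l))) (mat_vec p X (restr T (\<lambda>l. (1 / q) * d l)))
        \<le> 10 / (9 * real n)" .
  qed
qed

text \<open>Orthogonal projection; the bound on the length is Pythagoras.\<close>

lemma column_orthogonal_part_exists:
  assumes T: "T \<subseteq> {..<p}" and X: "ip n (col X j) (col X j) \<le> V"
  obtains a where
    "\<And>l. l \<in> T \<Longrightarrow> ip n (\<lambda>m. col X j m - mat_vec p X (restr T a) m) (col X l) = 0"
    "ip n (\<lambda>m. col X j m - mat_vec p X (restr T a) m) (\<lambda>m. col X j m - mat_vec p X (restr T a) m) \<le> V"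
proof -
  obtain a where a: "\<And>l. l \<in> T \<Longrightarrow> ip n (\<lambda>m. col X j m - mat_vec p X (restr T a) m) (col X l) = 0"
    using column_projection_exists[OF T] by blast
  define y where "y = mat_vec p X (restr T a)"
  define u where "u = (\<lambda>m. col X j m - y m)"
  have "ip n (col X l) u = 0" if "l \<in> T" for l
    using a[OF that] by (subst ip_commute) (simp add: u_def y_def)
  then have yu: "ip n y u = 0"
    unfolding y_def ip_mat_vec_restr[OF T] by (intro sum.neutral) auto
  have "col X j = (\<lambda>m. u m + y m)" by (simp add: u_def)
  then have "ip n (col X j) (col X j) = ip n u u + ip n y y"
    using yu ip_commute[of n u y] by (simp add: ip_linear)
  then have "ip n u u \<le> V" using X ip_self_nonneg[of n y] by simp
  then show ?thesis by (intro that[OF a]) (simp_all add: u_def y_def)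
qed

text \<open>Decompose \<open>w = X\<^sub>S t + Z\<close> with \<open>S\<close> the true support and \<open>Z\<close> orthogonal to its columns, and move the first part into the
  signal: \<open>\<theta> = \<beta>\<^sup>* + t\<close>. The functionals in the last two hypotheses are exactly
  \<open>t\<^sub>i\<close> and \<open>\<langle>X\<^sub>j, Z\<rangle>\<close>, written as inner products of \<open>w\<close> with vectors that depend on \<open>X\<close> only.\<close>

lemma RIP_noise_controls_local_minima:
  assumes rip: "RIP n p (2 * k) (1/10) X" and n: "n > 0" and k: "k > 0"
    and supp: "card (vec_support p \<beta>s) = k" and min: "abs_min p \<beta>s \<ge> 1"
    and Ss: "Ss = vec_support p \<beta>s"
    and v: "\<And>i l. i \<in> Ss \<Longrightarrow> l \<in> Ss \<Longrightarrow> ip n (mat_vec p X (restr Ss (d i))) (col X l) = (if l = i then 1 else 0)"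
    and u: "\<And>j l. j < p \<Longrightarrow> l \<in> Ss \<Longrightarrow> ip n (\<lambda>m. col X j m - mat_vec p X (restr Ss (a j)) m) (col X l) = 0"
    and v_small: "\<And>i. i \<in> Ss \<Longrightarrow> \<bar>ip n (mat_vec p X (restr Ss (d i))) w\<bar> < 1/2"
    and u_small: "\<And>j. j < p \<Longrightarrow> \<bar>ip n (\<lambda>m. col X j m - mat_vec p X (restr Ss (a j)) m) w\<bar> < real n / 20"
  shows "\<not> nontrivial_local_min n p k X (response p X \<beta>s w) \<beta>s \<beta>"
proof -
  have sub: "Ss \<subseteq> {..<p}" by (auto simp: Ss vec_support_def)
  have fin: "finite Ss" by (simp add: Ss)
  obtain t where t: "\<And>l. l \<in> Ss \<Longrightarrow> ip n (\<lambda>m. w m - mat_vec p X (restr Ss t) m) (col X l) = 0"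
    using column_projection_exists[OF sub] by blast
  define x where "x = mat_vec p X (restr Ss t)"
  define Z where "Z = (\<lambda>m. w m - x m)"
  have Zorth: "ip n (col X l) Z = 0" if "l \<in> Ss" for l
    using t[OF that] by (simp add: Z_def x_def ip_commute)
  have spanZ: "ip n (mat_vec p X (restr Ss b)) Z = 0" for b
    unfolding ip_mat_vec_restr[OF sub] using Zorth by (intro sum.neutral) auto
  have w: "w = (\<lambda>m. Z m + x m)" by (simp add: Z_def)
  have t_small: "\<bar>t i\<bar> < 1/2" if i: "i \<in> Ss" for i
  proof -
    let ?v = "mat_vec p X (restr Ss (d i))"
    have "ip n ?v w = ip n ?v x"
      by (subst w) (simp add: ip_add_right spanZ)
    also have "\<dots> = (\<Sum>l\<in>Ss. t l * ip n (col X l) ?v)"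
      unfolding x_def by (subst ip_commute) (rule ip_mat_vec_restr[OF sub])
    also have "\<dots> = (\<Sum>l\<in>Ss. if l = i then t i else 0)"
      using v[OF i] by (intro sum.cong) (auto simp: ip_commute[of n "col X _" ?v])
    also have "\<dots> = t i" using fin i by simp
    finally show ?thesis using v_small[OF i] by simp
  qed
  have noise: "\<bar>ip n (col X j) Z\<bar> \<le> real n / 20" if j: "j < p" for j
  proof -
    define y where "y = mat_vec p X (restr Ss (a j))"
    define z where "z = (\<lambda>m. col X j m - y m)"
    have "ip n (col X l) z = 0" if "l \<in> Ss" for l
      using u[OF j that] by (subst ip_commute) (simp add: z_def y_def)
    then have "ip n x z = 0"
      unfolding x_def ip_mat_vec_restr[OF sub] by (intro sum.neutral) auto
    then have zx: "ip n z x = 0" by (subst ip_commute)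
    have "col X j = (\<lambda>m. z m + y m)" by (simp add: z_def)
    then have "ip n (col X j) Z = ip n z Z" by (simp add: ip_add_left y_def spanZ)
    also have "\<dots> = ip n z w" by (subst w) (simp add: ip_add_right zx)
    finally show ?thesis using u_small[OF j] by (simp add: z_def y_def)
  qed
  define \<theta> where "\<theta> = (\<lambda>j. \<beta>s j + restr Ss t j)"
  have \<beta>s_ge: "1 \<le> \<bar>\<beta>s j\<bar>" if "j \<in> Ss" for j
  proof -
    have "abs_min p \<beta>s \<le> \<bar>\<beta>s j\<bar>"
      unfolding abs_min_def using that by (intro Min_le) (auto simp: Ss)
    then show ?thesis using min by simp
  qed
  have \<theta>_ge: "1/2 \<le> \<bar>\<theta> j\<bar>" if "j \<in> Ss" for j
    using \<beta>s_ge[OF that] t_small[OF that] that abs_triangle_ineq[of "\<theta> j" "- t j"]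
    by (simp add: \<theta>_def restr_def)
  have \<theta>0: "\<theta> j = 0" if "j < p" "j \<notin> Ss" for j
    using that by (simp add: \<theta>_def restr_def Ss vec_support_def)
  have supp\<theta>: "vec_support p \<theta> = Ss"
    using \<theta>0 \<theta>_ge sub by (force simp: vec_support_def)
  show ?thesis
  proof (rule no_nontrivial_local_min_deterministic[OF rip n, where \<theta> = \<theta> and Z = Z])
    show "response p X \<beta>s w = (\<lambda>i. mat_vec p X \<theta> i + Z i)"
      unfolding response_def \<theta>_def mat_vec_add by (simp add: Z_def x_def)
  qed (use supp supp\<theta> \<theta>_ge Zorth noise in \<open>auto simp: Ss\<close>)
qed

text \<open>For fixed \<open>X\<close> the relevant noise functionals are \<open>k + p\<close> fixed linear forms of a Gaussian vector, so a
  union bound suffices. No measurable choice of the coefficient vectors is involved, since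
  the bound is made separately for each \<open>X\<close>. The rate \<open>n / (880 \<sigma>\<^sup>2)\<close> is the one of the threshold
  \<open>n/20\<close> at variance \<open>11/10 n \<sigma>\<^sup>2\<close>; the other threshold gives a better one.\<close>

lemma RIP_local_min_prob_le:
  fixes n :: nat and \<sigma> :: real
  defines "M \<equiv> PiM {..<n} (\<lambda>_. normal_measure \<sigma>)"
  assumes rip: "RIP n p (2 * k) (1/10) X" and n: "n > 0" and k: "k > 0" and \<sigma>: "\<sigma> > 0"
    and supp: "card (vec_support p \<beta>s) = k" and min: "abs_min p \<beta>s \<ge> 1"
    and A: "\<And>w. w \<in> A \<Longrightarrow> w \<in> space M \<and> (\<exists>\<beta>. nontrivial_local_min n p k X (response p X \<beta>s w) \<beta>s \<beta>)"
  shows "emeasure M A \<le> ennreal (4 * real p * exp (- (real n / (880 * \<sigma>\<^sup>2))))"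
proof -
  define Ss where "Ss = vec_support p \<beta>s"
  define E where "E = exp (- (real n / (880 * \<sigma>\<^sup>2)))"
  have sub: "Ss \<subseteq> {..<p}" by (auto simp: Ss_def vec_support_def)
  have "\<exists>d. \<forall>i\<in>Ss. (\<forall>l\<in>Ss. ip n (mat_vec p X (restr Ss (d i))) (col X l) = (if l = i then 1 else 0)) \<and>
      ip n (mat_vec p X (restr Ss (d i))) (mat_vec p X (restr Ss (d i))) \<le> 10 / (9 * real n)"
  proof (intro bchoice ballI)
    fix i assume i: "i \<in> Ss"
    have "card Ss \<le> 2 * k" using supp by (simp add: Ss_def)
    from RIP_dual_vector_exists[OF rip n sub this i]
    show "\<exists>d. (\<forall>l\<in>Ss. ip n (mat_vec p X (restr Ss d)) (col X l) = (if l = i then 1 else 0)) \<and>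
      ip n (mat_vec p X (restr Ss d)) (mat_vec p X (restr Ss d)) \<le> 10 / (9 * real n)" by metis
  qed
  then obtain d where d: "\<And>i l. i \<in> Ss \<Longrightarrow> l \<in> Ss \<Longrightarrow> ip n (mat_vec p X (restr Ss (d i))) (col X l) = (if l = i then 1 else 0)"
      "\<And>i. i \<in> Ss \<Longrightarrow> ip n (mat_vec p X (restr Ss (d i))) (mat_vec p X (restr Ss (d i))) \<le> 10 / (9 * real n)"
    by blast
  define u where "u = (\<lambda>j a m. col X j m - mat_vec p X (restr Ss a) m)"
  have "\<exists>a. \<forall>j\<in>{..<p}. (\<forall>l\<in>Ss. ip n (u j (a j)) (col X l) = 0) \<and> ip n (u j (a j)) (u j (a j)) \<le> 11/10 * real n"
  proof (intro bchoice ballI)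
    fix j assume "j \<in> {..<p}"
    then have "ip n (col X j) (col X j) \<le> 11/10 * real n"
      using RIP_column[OF rip, of j] k by simp
    then show "\<exists>a. (\<forall>l\<in>Ss. ip n (u j a) (col X l) = 0) \<and> ip n (u j a) (u j a) \<le> 11/10 * real n"
      unfolding u_def by (rule column_orthogonal_part_exists[OF sub]) blast
  qed
  then obtain a where a: "\<And>j l. j < p \<Longrightarrow> l \<in> Ss \<Longrightarrow> ip n (u j (a j)) (col X l) = 0"
      "\<And>j. j < p \<Longrightarrow> ip n (u j (a j)) (u j (a j)) \<le> 11/10 * real n"
    by (metis lessThan_iff)
  define BV where "BV = (\<lambda>i. {w \<in> space M. 1/2 \<le> \<bar>ip n (mat_vec p X (restr Ss (d i))) w\<bar>})"
  define BU where "BU = (\<lambda>j. {w \<in> space M. real n / 20 \<le> \<bar>ip n (u j (a j)) w\<bar>})"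
  have BV: "BV i \<in> sets M" "emeasure M (BV i) \<le> ennreal (2 * E)" if "i \<in> Ss" for i
  proof -
    have V: "10 / (9 * real n) > 0" using n by simp
    note tail = gaussian_vector_tail[OF \<sigma> V _ d(2)[OF that], of "1/2"]
    show "BV i \<in> sets M" using tail(1) unfolding BV_def M_def by simp
    have "real n / (880 * \<sigma>\<^sup>2) \<le> (1/2)\<^sup>2 / (2 * \<sigma>\<^sup>2 * (10 / (9 * real n)))"
      using \<sigma> n by (simp add: field_simps power2_eq_square)
    then have "ennreal (2 * exp (- ((1/2)\<^sup>2 / (2 * \<sigma>\<^sup>2 * (10 / (9 * real n)))))) \<le> ennreal (2 * E)"
      unfolding E_def by (intro ennreal_leI mult_left_mono) auto
    then show "emeasure M (BV i) \<le> ennreal (2 * E)"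
      using tail(2) unfolding BV_def M_def by (meson order_trans half_gt_zero zero_less_one)
  qed
  have BU: "BU j \<in> sets M" "emeasure M (BU j) \<le> ennreal (2 * E)" if "j < p" for j
  proof -
    have V: "11/10 * real n > 0" and t: "real n / 20 > 0" using n by auto
    note tail = gaussian_vector_tail[OF \<sigma> V t a(2)[OF that]]
    show "BU j \<in> sets M" using tail(1) unfolding BU_def M_def by simp
    have "(real n / 20)\<^sup>2 / (2 * \<sigma>\<^sup>2 * (11/10 * real n)) = real n / (880 * \<sigma>\<^sup>2)"
      using \<sigma> n by (simp add: field_simps power2_eq_square)
    then show "emeasure M (BU j) \<le> ennreal (2 * E)"
      using tail(2) unfolding BU_def M_def E_def by simp
  qed
  have "A \<subseteq> (\<Union>i\<in>Ss. BV i) \<union> (\<Union>j\<in>{..<p}. BU j)"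
  proof (rule subsetI, rule ccontr)
    fix w assume w: "w \<in> A" "w \<notin> (\<Union>i\<in>Ss. BV i) \<union> (\<Union>j\<in>{..<p}. BU j)"
    have "\<not> nontrivial_local_min n p k X (response p X \<beta>s w) \<beta>s \<beta>" for \<beta>
      by (rule RIP_noise_controls_local_minima[OF rip n k supp min Ss_def d(1) a(1)[unfolded u_def]])
        (use w A[of w] in \<open>auto simp: BV_def BU_def u_def not_le\<close>)
    then show False using A[OF w(1)] by blast
  qed
  then have "emeasure M A \<le> emeasure M ((\<Union>i\<in>Ss. BV i) \<union> (\<Union>j\<in>{..<p}. BU j))"
    using BV BU sub by (intro emeasure_mono) (auto simp: Ss_def)
  also have "\<dots> \<le> emeasure M (\<Union>i\<in>Ss. BV i) + emeasure M (\<Union>j\<in>{..<p}. BU j)"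
    using BV BU by (intro emeasure_subadditive) (auto simp: Ss_def)
  also have "\<dots> \<le> (\<Sum>i\<in>Ss. emeasure M (BV i)) + (\<Sum>j<p. emeasure M (BU j))"
    using BV BU by (intro add_mono emeasure_subadditive_finite) (auto simp: Ss_def)
  also have "\<dots> \<le> (\<Sum>i\<in>Ss. ennreal (2 * E)) + (\<Sum>j<p. ennreal (2 * E))"
    using BV BU by (intro add_mono sum_mono) auto
  also have "\<dots> \<le> (\<Sum>j<p. ennreal (2 * E)) + (\<Sum>j<p. ennreal (2 * E))"
    using sub by (intro add_mono sum_mono2) auto
  also have "\<dots> = ennreal (4 * real p * E)"
    by (simp add: E_def ennreal_of_nat_eq_real_of_nat ennreal_mult[symmetric] ennreal_plus[symmetric] del: ennreal_plus)
  finally show ?thesis by (simp add: E_def)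
qed

section \<open>Absence of nontrivial local minima\<close>

text \<open>Fubini: integrate the bound for fixed \<open>X\<close> over the good matrices and add the probability of the bad
  ones. The constant \<open>57600 = 9 \<cdot> 6400\<close> lets the exponent \<open>n / 6400 \<ge> 9 k ln p\<close> absorb the
  \<open>p\<^bsup>8k\<^esup>\<close> grid points. As \<open>\<sigma>\<^sup>2 \<le> k\<close>, it also makes \<open>n / (880 \<sigma>\<^sup>2) \<ge> 2 ln p\<close>, which pays for the \<open>p\<close>
  linear forms.\<close>

lemma local_min_prob_le:
  assumes n: "n > 0" and k: "k > 0" and \<sigma>: "\<sigma> > 0" and p: "p \<ge> 200" and kp: "real k \<le> real p / 3"
    and \<sigma>k: "\<sigma>\<^sup>2 \<le> real k" and nk: "real n \<ge> 57600 * real k * ln (real p)"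
    and supp: "card (vec_support p \<beta>s) = k" and min: "abs_min p \<beta>s \<ge> 1"
  shows "emeasure (gaussian_model n p \<sigma>)
      {(X, W) \<in> space (gaussian_model n p \<sigma>). \<exists>\<beta>. nontrivial_local_min n p k X (response p X \<beta>s W) \<beta>s \<beta>}
    \<le> ennreal (6 / real p)"
proof -
  let ?A = "gaussian_matrix n p"
  let ?B = "PiM {..<n} (\<lambda>_. normal_measure \<sigma>)"
  define N where "N = {(X, W) \<in> space (gaussian_model n p \<sigma>).
      \<exists>\<beta>. nontrivial_local_min n p k X (response p X \<beta>s W) \<beta>s \<beta>}"
  interpret A: prob_space ?A by (rule prob_space_gaussian_matrix)
  interpret B: prob_space ?B by (intro prob_space_PiM prob_space_normal_density \<sigma>)
  have M: "gaussian_model n p \<sigma> = ?A \<Otimes>\<^sub>M ?B" by (simp add: gaussian_model_def)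
  have N: "N \<in> sets (?A \<Otimes>\<^sub>M ?B)"
    using sets_Collect_nontrivial_local_min[of n p \<sigma> k \<beta>s] unfolding N_def M .
  have "1 \<le> 2 * k" "2 * k \<le> p" using k kp by linarith+
  from gaussian_matrix_RIP[OF n p this] obtain G where G: "G \<in> sets ?A"
    "emeasure ?A G \<le> ennreal (2 * real p ^ (4 * (2 * k)) * exp (- (real n / 6400)))"
    "\<And>X. X \<in> space ?A - G \<Longrightarrow> RIP n p (2 * k) (1/10) X" by blast
  have lnp: "ln (real p) > 0" using p by simp
  have pexp: "real p ^ m = exp (real m * ln (real p))" for m
    using p by (simp add: exp_of_nat_mult)
  have inv: "1 / real p = exp (- ln (real p))" using p by (simp add: exp_minus divide_inverse)
  have k1: "real k * ln (real p) \<ge> 1 * ln (real p)" using k lnp by (intro mult_right_mono) auto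
  have "2 * real p ^ (4 * (2 * k)) * exp (- (real n / 6400)) = 2 * exp (8 * (real k * ln (real p)) - real n / 6400)"
    unfolding pexp by (simp add: mult_exp_exp mult.assoc)
  also have "\<dots> \<le> 2 * (1 / real p)"
    unfolding inv using nk k1 by (intro mult_left_mono) (auto simp: mult.assoc)
  finally have G_le: "emeasure ?A G \<le> ennreal (2 / real p)"
    by (intro order_trans[OF G(2)] ennreal_leI) simp
  have tail: "4 * real p * exp (- (real n / (880 * \<sigma>\<^sup>2))) \<le> 4 / real p"
  proof -
    have "2 * ln (real p) * (880 * \<sigma>\<^sup>2) \<le> 2 * ln (real p) * (880 * real k)"
      using \<sigma>k lnp by (intro mult_left_mono) auto
    also have "\<dots> \<le> real n" using nk k1 lnp by (simp add: mult.assoc mult.commute[of "real k"])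
    finally have "2 * ln (real p) \<le> real n / (880 * \<sigma>\<^sup>2)" using \<sigma> by (simp add: field_simps)
    then have "exp (- (real n / (880 * \<sigma>\<^sup>2))) \<le> exp (- ln (real p) + - ln (real p))" by simp
    also have "\<dots> = (1 / real p) * (1 / real p)" by (simp only: exp_add inv)
    finally have "4 * real p * exp (- (real n / (880 * \<sigma>\<^sup>2))) \<le> 4 * real p * ((1 / real p) * (1 / real p))"
      by (intro mult_left_mono) auto
    then show ?thesis using p by simp
  qed
  have fibre: "emeasure ?B (Pair X -` N) \<le> indicator G X + ennreal (4 / real p)"
    if X: "X \<in> space ?A" for X
  proof (cases "X \<in> G")
    case True
    have "emeasure ?B (Pair X -` N) \<le> 1" by (rule B.emeasure_le_1)
    also have "\<dots> \<le> 1 + ennreal (4 / real p)" by simp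
    finally show ?thesis using True by simp
  next
    case False
    have "emeasure ?B (Pair X -` N) \<le> ennreal (4 * real p * exp (- (real n / (880 * \<sigma>\<^sup>2))))"
    proof (rule RIP_local_min_prob_le[OF _ n k \<sigma> supp min])
      show "RIP n p (2 * k) (1/10) X" using G(3) X False by blast
      fix w assume "w \<in> Pair X -` N"
      then show "w \<in> space ?B \<and> (\<exists>\<beta>. nontrivial_local_min n p k X (response p X \<beta>s w) \<beta>s \<beta>)"
        by (auto simp: N_def M space_pair_measure)
    qed
    also have "\<dots> \<le> ennreal (4 / real p)" by (rule ennreal_leI[OF tail])
    finally show ?thesis using False by simp
  qed
  have "emeasure (?A \<Otimes>\<^sub>M ?B) N = (\<integral>\<^sup>+X. emeasure ?B (Pair X -` N) \<partial>?A)"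
    by (rule B.emeasure_pair_measure_alt[OF N])
  also have "\<dots> \<le> (\<integral>\<^sup>+X. indicator G X + ennreal (4 / real p) \<partial>?A)"
    by (intro nn_integral_mono fibre)
  also have "\<dots> = emeasure ?A G + ennreal (4 / real p)"
    using G(1) A.emeasure_space_1 by (subst nn_integral_add) auto
  also have "\<dots> \<le> ennreal (2 / real p) + ennreal (4 / real p)"
    by (intro add_mono G_le order_refl)
  also have "\<dots> = ennreal (6 / real p)"
    by (subst ennreal_plus[symmetric]) (auto simp: add_divide_distrib[symmetric])
  finally show ?thesis unfolding N_def M .
qed

theorem theorem2p6:
  "\<exists>c C :: real. c > 0 \<and> C > 0 \<and>
     (\<forall>\<epsilon> :: real. \<epsilon> > 0 \<longrightarrow> (\<exists>k\<^sub>0 :: nat.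
       \<forall>(n :: nat) (p :: nat) (k :: nat) (\<sigma> :: real) (\<beta>s :: nat \<Rightarrow> real).
         n > 0 \<and> p > 0 \<and> k > 0 \<and> \<sigma> > 0 \<and> k \<ge> k\<^sub>0 \<and>
         real k \<le> real p / 3 \<and>
         \<sigma>\<^sup>2 \<le> c * min (real k) (ln (real p) / ln (ln (real p))) \<and>
         real n \<ge> C * real k * ln (real p) \<and>
         card (vec_support p \<beta>s) = k \<and>
         abs_min p \<beta>s \<ge> 1 \<longrightarrow>
         \<P>((X, W) in gaussian_model n p \<sigma>.
            \<not> (\<exists>\<beta>. nontrivial_local_min n p k X (response p X \<beta>s W) \<beta>s \<beta>)) \<ge> 1 - \<epsilon>))"
proof (rule exI[of _ 1], rule exI[of _ 57600], intro conjI allI impI)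
  fix \<epsilon> :: real
  assume \<epsilon>: "\<epsilon> > 0"
  show "\<exists>k\<^sub>0 :: nat. \<forall>(n :: nat) (p :: nat) (k :: nat) (\<sigma> :: real) (\<beta>s :: nat \<Rightarrow> real).
         n > 0 \<and> p > 0 \<and> k > 0 \<and> \<sigma> > 0 \<and> k \<ge> k\<^sub>0 \<and>
         real k \<le> real p / 3 \<and>
         \<sigma>\<^sup>2 \<le> 1 * min (real k) (ln (real p) / ln (ln (real p))) \<and>
         real n \<ge> 57600 * real k * ln (real p) \<and>
         card (vec_support p \<beta>s) = k \<and>
         abs_min p \<beta>s \<ge> 1 \<longrightarrow>
         \<P>((X, W) in gaussian_model n p \<sigma>.
            \<not> (\<exists>\<beta>. nontrivial_local_min n p k X (response p X \<beta>s W) \<beta>s \<beta>)) \<ge> 1 - \<epsilon>"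
  proof (rule exI[of _ "nat \<lceil>2 / \<epsilon>\<rceil> + 67"], intro allI impI, elim conjE)
    \<comment> \<open>Since \<open>p \<ge> 3k\<close>, the summand \<open>67\<close> gives \<open>p \<ge> 200\<close> and \<open>2 / \<epsilon>\<close> gives \<open>6 / p \<le> \<epsilon>\<close>.\<close>
    fix n p k :: nat and \<sigma> :: real and \<beta>s :: "nat \<Rightarrow> real"
    assume n: "n > 0" and k: "k > 0" and \<sigma>: "\<sigma> > 0" and k0: "nat \<lceil>2 / \<epsilon>\<rceil> + 67 \<le> k"
      and kp: "real k \<le> real p / 3" and \<sigma>2: "\<sigma>\<^sup>2 \<le> 1 * min (real k) (ln (real p) / ln (ln (real p)))"
      and nk: "real n \<ge> 57600 * real k * ln (real p)"
      and supp: "card (vec_support p \<beta>s) = k" and min: "abs_min p \<beta>s \<ge> 1"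
    let ?M = "gaussian_model n p \<sigma>"
    let ?N = "{(X, W) \<in> space ?M. \<exists>\<beta>. nontrivial_local_min n p k X (response p X \<beta>s W) \<beta>s \<beta>}"
    interpret A: prob_space "gaussian_matrix n p" by (rule prob_space_gaussian_matrix)
    interpret B: prob_space "PiM {..<n} (\<lambda>_. normal_measure \<sigma>)"
      by (intro prob_space_PiM prob_space_normal_density \<sigma>)
    interpret AB: pair_prob_space "gaussian_matrix n p" "PiM {..<n} (\<lambda>_. normal_measure \<sigma>)" ..
    interpret M: prob_space ?M
      unfolding gaussian_model_def by (rule AB.prob_space_axioms)
    have p200: "p \<ge> 200" using kp k0 by linarith
    have "2 / \<epsilon> \<le> real k" using k0 by linarith
    then have "2 / \<epsilon> * 3 \<le> real p" using kp by linarith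
    then have small: "6 / real p \<le> \<epsilon>" using \<epsilon> p200 by (simp add: field_simps)
    have "\<sigma>\<^sup>2 \<le> real k" using \<sigma>2 by simp
    from local_min_prob_le[OF n k \<sigma> p200 kp this nk supp min]
    have "M.prob ?N \<le> 6 / real p"
      by (simp add: M.emeasure_eq_measure)
    moreover have "M.prob (space ?M - ?N) = 1 - M.prob ?N"
      by (rule M.prob_compl) (rule sets_Collect_nontrivial_local_min)
    moreover have "space ?M - ?N = {(X, W) \<in> space ?M.
        \<not> (\<exists>\<beta>. nontrivial_local_min n p k X (response p X \<beta>s W) \<beta>s \<beta>)}" by auto
    ultimately show "1 - \<epsilon> \<le> \<P>((X, W) in ?M.
            \<not> (\<exists>\<beta>. nontrivial_local_min n p k X (response p X \<beta>s W) \<beta>s \<beta>))"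
      using small by simp
  qed
qed auto

end
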